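(* Let $D$ be a connected oriented graph such that $H_\omega(D)$ has exactly two distinct eigenvalues. Then $D$ is isomorphic to one of the following: (a) the directed edge (one arc on two vertices), whose $H_\omega$-eigenvalues are $\{1,-1\}$; (b) the directed triangle (arcs $a\to b\to c\to a$), whose $H_\omega$-eigenvalues are $\{1,-2\}$; (c) the oriented graph $D_{3,3}$ with vertices $u,v,w,x,y,z$ and arcs $u\to x$, $x\to v$, $v\to z$, $z\to u$, $u\to y$, $v\to y$, $w\to z$, $w\to x$, $y\to w$ (an orientation of $K_{3,3}$ with parts $\{u,v,w\}$, $\{x,y,z\}$), whose $H_\omega$-eigenvalues are $\{\sqrt3,-\sqrt3\}$; (d) the oriented graph $D_{5,5}$ with vertices $v_1,w_1,x_1,y_1,z_1,v_2,w_2,x_2,y_2,z_2$ and the $20$ arcs $v_1\to w_2$, $v_1\to x_2$, $y_2\to v_1$, $z_2\to v_1$, $x_2\to w_1$, $w_2\to x_1$, $y_1\to z_2$, $z_1\to y_2$, $w_2\to y_1$, $y_1\to x_2$, $x_2\to z_1$, $z_1\to w_2$, $v_2\to y_1$, $v_2\to z_1$, $w_1\to y_2$, $y_2\to x_1$, $x_1\to z_2$, $z_2\to w_1$, $w_1\to v_2$, $x_1\to v_2$ (an orientation of $K_{5,5}$ minus the perfect matching $\{a_1a_2: a\in\{v,w,x,y,z\}\}$), whose $H_\omega$-eigenvalues are $\{2,-2\}$.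
   Context: An oriented graph $D=(V,A)$ is a loopless directed graph in which for each pair of distinct vertices $u,v$ at most one of $(u,v),(v,u)$ is an arc; write $u\to v$ if $(u,v)\in A$. Its underlying graph is the simple graph with an edge $\{u,v\}$ whenever $u\to v$ or $v\to u$; $D$ is connected if its underlying graph is. Let $\omega=\frac{1+i\sqrt3}{2}$. The Hermitian adjacency matrix $H_\omega(D)$ is the $V\times V$ matrix with $(u,v)$-entry $\omega$ if $u\to v$, $\overline{\omega}$ if $v\to u$, and $0$ otherwise. The $H_\omega$-eigenvalues of $D$ are the (real) eigenvalues of $H_\omega(D)$.
   Formalization: In (d) the four arcs w_2→y_1, y_1→x_2, x_2→z_1, z_1→w_2 are reversed to y_1→w_2, x_2→y_1, z_1→x_2, w_2→z_1: with the printed arcs the (w_1,y_1) entry of H^2 is nonzero, so the eigenvalues are not {2,-2}. *)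

theory Defs
  imports Complex_Main "Graph_Theory.Graph_Theory" "Jordan_Normal_Form.Spectral_Radius"
begin

locale oriented_graph = pair_digraph D for D :: "'a pair_pre_digraph" +
  assumes asym_arcs: "(u, v) \<in> parcs D \<Longrightarrow> (v, u) \<notin> parcs D"

definition omega :: complex where
  "omega = (1 + \<i> * complex_of_real (sqrt 3)) / 2"

definition H_entry :: "'a pair_pre_digraph \<Rightarrow> 'a \<Rightarrow> 'a \<Rightarrow> complex" where
  "H_entry D u v =
     (if (u, v) \<in> parcs D then omega else if (v, u) \<in> parcs D then cnj omega else 0)"

(* Matrices of type complex mat are indexed by {0..<n}, so the V x V matrix is written down
   along a listing vs of V. Different listings give permutation-similar matrices, hence the same
   eigenvalues (lemma H_spectrum_eq). *)
definition H_omega :: "'a pair_pre_digraph \<Rightarrow> 'a list \<Rightarrow> complex mat" where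
  "H_omega D vs = mat (length vs) (length vs) (\<lambda>(i, j). H_entry D (vs ! i) (vs ! j))"

definition H_spectrum :: "'a pair_pre_digraph \<Rightarrow> complex set" where
  "H_spectrum D = \<Union> {spectrum (H_omega D vs) |vs. distinct vs \<and> set vs = pverts D}"

lemma eigenvalue_H_omega_iff:
  assumes vs: "distinct vs"
  shows "eigenvalue (H_omega D vs) k \<longleftrightarrow>
    (\<exists>f. (\<exists>u\<in>set vs. f u \<noteq> 0) \<and> (\<forall>u\<in>set vs. (\<Sum>v\<in>set vs. H_entry D u v * f v) = k * f u))"
    (is "?L \<longleftrightarrow> ?R")
proof -
  let ?n = "length vs"
  have sum_set: "(\<Sum>v\<in>set vs. g v) = (\<Sum>j = 0..<?n. g (vs ! j))" for g :: "_ \<Rightarrow> complex"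
    using sum.reindex_bij_betw[OF bij_betw_nth[OF vs refl refl], of g]
    by (simp add: atLeast0LessThan)
  have mv: "(H_omega D vs *\<^sub>v x) $ i = (\<Sum>j = 0..<?n. H_entry D (vs ! i) (vs ! j) * x $ j)"
    if "i < ?n" "x \<in> carrier_vec ?n" for i x
    using that by (simp add: H_omega_def scalar_prod_def)
  show ?thesis
  proof
    assume ?L
    then obtain x where x: "x \<in> carrier_vec ?n" "x \<noteq> 0\<^sub>v ?n" "H_omega D vs *\<^sub>v x = k \<cdot>\<^sub>v x"
      unfolding eigenvalue_def eigenvector_def by (auto simp: H_omega_def)
    define f where "f v = x $ (THE i. i < ?n \<and> vs ! i = v)" for v
    have f: "f (vs ! i) = x $ i" if "i < ?n" for i
    proof -
      have "(THE j. j < ?n \<and> vs ! j = vs ! i) = i"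
        using that vs by (intro the_equality) (auto simp: nth_eq_iff_index_eq)
      then show ?thesis by (simp add: f_def)
    qed
    have "\<exists>i<?n. x $ i \<noteq> 0"
    proof (rule ccontr)
      assume "\<not> ?thesis"
      then have "x = 0\<^sub>v ?n" using x(1) by (intro eq_vecI) auto
      with x(2) show False by simp
    qed
    then have nz: "\<exists>u\<in>set vs. f u \<noteq> 0" using f by (metis nth_mem)
    have "(\<Sum>j = 0..<?n. H_entry D (vs ! i) (vs ! j) * f (vs ! j)) = k * f (vs ! i)"
      if i: "i < ?n" for i
    proof -
      have "(\<Sum>j = 0..<?n. H_entry D (vs ! i) (vs ! j) * f (vs ! j)) = (H_omega D vs *\<^sub>v x) $ i"
        by (simp add: mv[OF i x(1)] f)
      also have "\<dots> = k * f (vs ! i)" using i x(1) by (simp add: x(3) f)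
      finally show ?thesis .
    qed
    then show ?R using nz by (intro exI[of _ f]) (auto simp: sum_set in_set_conv_nth)
  next
    assume ?R
    then obtain f where nz: "\<exists>u\<in>set vs. f u \<noteq> 0"
      and ev: "\<And>u. u \<in> set vs \<Longrightarrow> (\<Sum>v\<in>set vs. H_entry D u v * f v) = k * f u" by blast
    let ?x = "vec ?n (\<lambda>i. f (vs ! i))"
    have "?x \<noteq> 0\<^sub>v ?n"
    proof
      assume "?x = 0\<^sub>v ?n"
      then have "f (vs ! i) = 0" if "i < ?n" for i
        using that by (metis index_vec index_zero_vec(1))
      with nz show False by (auto simp: in_set_conv_nth)
    qed
    moreover have "H_omega D vs *\<^sub>v ?x = k \<cdot>\<^sub>v ?x"
    proof (rule eq_vecI)
      fix i assume "i < dim_vec (k \<cdot>\<^sub>v ?x)"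
      then have i: "i < ?n" by simp
      show "(H_omega D vs *\<^sub>v ?x) $ i = (k \<cdot>\<^sub>v ?x) $ i"
        using ev[of "vs ! i"] i by (simp add: mv sum_set)
    qed (simp add: H_omega_def)
    ultimately show ?L
      unfolding eigenvalue_def eigenvector_def
      by (intro exI[of _ ?x]) (auto simp: H_omega_def)
  qed
qed

lemma H_spectrum_eq:
  assumes "distinct vs" "set vs = pverts D"
  shows "H_spectrum D = spectrum (H_omega D vs)"
proof -
  have "spectrum (H_omega D ws) = spectrum (H_omega D vs)"
    if "distinct ws" "set ws = pverts D" for ws
    unfolding spectrum_def eigenvalue_H_omega_iff[OF that(1)] eigenvalue_H_omega_iff[OF assms(1)]
      that(2) assms(2) ..
  then show ?thesis using assms unfolding H_spectrum_def by blast
qed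

definition directed_edge :: "nat pair_pre_digraph" where
  "directed_edge = \<lparr> pverts = {0, 1}, parcs = {(0, 1)} \<rparr>"

definition directed_triangle :: "nat pair_pre_digraph" where
  "directed_triangle = \<lparr> pverts = {0, 1, 2}, parcs = {(0, 1), (1, 2), (2, 0)} \<rparr>"

datatype vertex33 = U | V | W | X | Y | Z

definition D33 :: "vertex33 pair_pre_digraph" where
  "D33 = \<lparr> pverts = {U, V, W, X, Y, Z},
           parcs = {(U, X), (X, V), (V, Z), (Z, U), (U, Y), (V, Y), (W, Z), (W, X), (Y, W)} \<rparr>"

datatype vertex55 = V1 | W1 | X1 | Y1 | Z1 | V2 | W2 | X2 | Y2 | Z2

(* The third line of arcs is the directed 4-cycle y1 -> w2 -> z1 -> x2 -> y1. The arc list in the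
   source has this cycle in the opposite direction, which is a misprint: the (w1, y1) entry of
   the square of the matrix is then omega^2 + 2 * cnj omega^2 instead of 0, and the eigenvalues are
   2, -2 and the four numbers (+-1) +- sqrt 3. With the direction used here the square is
   4 times the identity. The only other way to repair the printed list by reversing at most four
   arcs is to reverse the cycle w1 -> y2 -> x1 -> z2 -> w1 instead; the result is isomorphic. *)
definition D55 :: "vertex55 pair_pre_digraph" where
  "D55 = \<lparr> pverts = {V1, W1, X1, Y1, Z1, V2, W2, X2, Y2, Z2},
           parcs = {(V1, W2), (V1, X2), (Y2, V1), (Z2, V1),
                    (X2, W1), (W2, X1), (Y1, Z2), (Z1, Y2),
                    (Y1, W2), (X2, Y1), (Z1, X2), (W2, Z1),
                    (V2, Y1), (V2, Z1), (W1, Y2), (Y2, X1),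
                    (X1, Z2), (Z2, W1), (W1, V2), (X1, V2)} \<rparr>"

lemma oriented_graph_directed_edge: "oriented_graph directed_edge"
  and oriented_graph_directed_triangle: "oriented_graph directed_triangle"
  and oriented_graph_D33: "oriented_graph D33"
  and oriented_graph_D55: "oriented_graph D55"
  by (unfold_locales;
      auto simp: directed_edge_def directed_triangle_def D33_def D55_def)+

lemma D33_underlying:
  "parcs (mk_symmetric D33) = {U, V, W} \<times> {X, Y, Z} \<union> {X, Y, Z} \<times> {U, V, W}"
proof (rule Set.set_eqI, unfold split_paired_all)
  fix a b
  show "(a, b) \<in> parcs (mk_symmetric D33) \<longleftrightarrow>
      (a, b) \<in> {U, V, W} \<times> {X, Y, Z} \<union> {X, Y, Z} \<times> {U, V, W}"
    by (cases a; cases b; simp add: mk_symmetric_def D33_def)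
qed

lemma D55_underlying:
  defines "P \<equiv> {V1, W1, X1, Y1, Z1}" and "Q \<equiv> {V2, W2, X2, Y2, Z2}"
    and "M \<equiv> {(V1, V2), (W1, W2), (X1, X2), (Y1, Y2), (Z1, Z2)}"
  shows "parcs (mk_symmetric D55) = (P \<times> Q - M) \<union> (Q \<times> P - M\<inverse>)"
proof (rule Set.set_eqI, unfold split_paired_all)
  fix a b
  show "(a, b) \<in> parcs (mk_symmetric D55) \<longleftrightarrow> (a, b) \<in> (P \<times> Q - M) \<union> (Q \<times> P - M\<inverse>)"
    unfolding P_def Q_def M_def by (cases a; cases b; simp add: mk_symmetric_def D55_def)
qed

end

theory Submission
  imports Defs
begin

text \<open>
  Let \<open>\<theta>\<close>, \<open>\<tau>\<close> be the two eigenvalues, \<open>a = \<theta> + \<tau>\<close>, \<open>k = - \<theta> \<tau>\<close>, and let \<open>M\<close> be the 0-1 arc matrix with transpose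
  \<open>M'\<close>. A Hermitian matrix is annihilated by the product over its distinct eigenvalues, so
  \<open>H H = a H + k I\<close>, and comparing real and imaginary parts gives
  \<open>M M + a M' = M M' + M' M - k I\<close>. The diagonal says that every vertex has degree \<open>k\<close>. Summed over the
  arcs, the equation counts each transitive triangle once on the left and twice on the right, so there
  are none, and each arc lies on exactly \<open>-a\<close> directed triangles. Summed over all pairs of
  vertices, it says that the out-degrees \<open>d\<close> satisfy \<open>\<Sum>(2 d - k)\<^sup>2 = k n (4 + 2 a - k) / 3\<close>, whence
  \<open>k \<le> 4 + 2 a\<close>. If \<open>a < 0\<close> this leaves the directed triangle. If \<open>a = 0\<close>, then \<open>k \<le> 4\<close>, the underlying
  graph is triangle-free, and two vertices \<open>u\<close>, \<open>v\<close> with a common neighbour have exactly three, exactly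
  one of which lies on a directed path from \<open>u\<close> to \<open>v\<close>. This forces the underlying graph to be
  \<open>K\<^sub>2\<close>, \<open>K\<^sub>3\<^sub>,\<^sub>3\<close> or \<open>K\<^sub>5\<^sub>,\<^sub>5\<close> minus a perfect matching; in the second case the arcs leaving one of the parts
  form a perfect matching, and in the third case they describe a 5-cycle on the matched pairs.
\<close>

section \<open>Hermitian matrices with two eigenvalues\<close>

text \<open>Vectors are functions on the whole type, so matrices need no listing of
  \<open>A\<close>; values of \<open>f\<close> outside \<open>A\<close> never enter the sum.\<close>

definition mat_op :: "'a set \<Rightarrow> ('a \<Rightarrow> 'a \<Rightarrow> complex) \<Rightarrow> ('a \<Rightarrow> complex) \<Rightarrow> 'a \<Rightarrow> complex" where
  "mat_op A h f = (\<lambda>u. \<Sum>v\<in>A. h u v * f v)"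

lemma mat_op_diff_scale: "mat_op A h (\<lambda>u. f u - c * g u) = (\<lambda>u. mat_op A h f u - c * mat_op A h g u)"
  by (simp add: mat_op_def right_diff_distrib sum_subtractf sum_distrib_left mult.left_commute)

lemma mat_op_pow_diff_scale:
  "(mat_op A h ^^ n) (\<lambda>u. f u - c * g u) = (\<lambda>u. (mat_op A h ^^ n) f u - c * (mat_op A h ^^ n) g u)"
  by (induction n) (simp_all add: mat_op_diff_scale)

text \<open>If \<open>A\<close> has \<open>n\<close> elements, the \<open>n + 1\<close> vectors
  \<open>(T ^^ j) x\<close> with \<open>j \<le> n\<close> are linearly dependent on
  \<open>A\<close>; the coefficients of a dependence form \<open>p\<close>.\<close>

lemma annihilating_poly_exists:
  fixes x :: "'a \<Rightarrow> complex" and T :: "('a \<Rightarrow> complex) \<Rightarrow> 'a \<Rightarrow> complex"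
  assumes "finite A"
  shows "\<exists>p. p \<noteq> 0 \<and> (\<forall>u\<in>A. (\<Sum>j\<le>degree p. coeff p j * (T ^^ j) x u) = 0)"
proof -
  obtain vs where vs: "distinct vs" "set vs = A" using finite_distinct_list[OF assms] by blast
  define n where "n = length vs"
  \<comment> \<open>A zero row pads the \<open>n\<close> by \<open>n + 1\<close> system to a square
    matrix of determinant 0, which yields a nonzero kernel vector \<open>c\<close>.\<close>
  define K where "K = mat\<^sub>r (Suc n) (Suc n)
    (\<lambda>i. if i = n then 0\<^sub>v (Suc n) else vec (Suc n) (\<lambda>j. (T ^^ j) x (vs ! i)))"
  have K: "K \<in> carrier_mat (Suc n) (Suc n)" by (simp add: K_def)
  have "det K = 0" unfolding K_def by (rule det_row_0) auto
  then obtain c where c: "c \<in> carrier_vec (Suc n)" "c \<noteq> 0\<^sub>v (Suc n)" "K *\<^sub>v c = 0\<^sub>v (Suc n)"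
    using det_0_iff_vec_prod_zero[OF K] by blast
  define p where "p = Poly (map (\<lambda>j. c $ j) [0..<Suc n])"
  have cp: "coeff p j = (if j \<le> n then c $ j else 0)" for j
    by (auto simp: p_def coeff_Poly_eq nth_default_def nth_append simp del: upt_Suc)
  have "p \<noteq> 0"
  proof
    assume "p = 0"
    then have "c $ j = 0" if "j < Suc n" for j using cp[of j] that by simp
    then have "c = 0\<^sub>v (Suc n)" using c(1) by (intro eq_vecI) auto
    with c(2) show False by simp
  qed
  moreover have "(\<Sum>j\<le>degree p. coeff p j * (T ^^ j) x u) = 0" if u: "u \<in> A" for u
  proof -
    obtain i where i: "i < n" "u = vs ! i"
      using u vs(2) unfolding n_def by (metis in_set_conv_nth)
    have "(\<Sum>j\<le>degree p. coeff p j * (T ^^ j) x u) = (\<Sum>j\<in>{..n}. coeff p j * (T ^^ j) x u)"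
    proof (rule sum.mono_neutral_left)
      have "degree p \<le> n" by (rule degree_le) (simp add: cp)
      then show "{..degree p} \<subseteq> {..n}" by auto
    qed (auto simp: coeff_eq_0)
    also have "\<dots> = (\<Sum>j = 0..<Suc n. c $ j * (T ^^ j) x u)"
      by (intro sum.cong) (auto simp: cp)
    also have "\<dots> = (K *\<^sub>v c) $ i"
      using i c(1) by (simp add: K_def scalar_prod_def mult.commute)
    finally show ?thesis using c(3) i by simp
  qed
  ultimately show ?thesis by blast
qed

locale hermitian_kernel =
  fixes A :: "'a set" and h :: "'a \<Rightarrow> 'a \<Rightarrow> complex"
  assumes fin: "finite A" and herm: "\<And>u v. \<lbrakk>u \<in> A; v \<in> A\<rbrakk> \<Longrightarrow> h u v = cnj (h v u)"
begin

abbreviation T where "T \<equiv> mat_op A h"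

definition is_eigenvalue :: "complex \<Rightarrow> bool" where
  "is_eigenvalue c \<longleftrightarrow> (\<exists>f. (\<exists>u\<in>A. f u \<noteq> 0) \<and> (\<forall>u\<in>A. T f u = c * f u))"

lemma self_adjoint: "(\<Sum>u\<in>A. T f u * cnj (g u)) = (\<Sum>u\<in>A. f u * cnj (T g u))"
proof -
  have "(\<Sum>u\<in>A. T f u * cnj (g u)) = (\<Sum>u\<in>A. \<Sum>v\<in>A. h u v * f v * cnj (g u))"
    by (simp add: mat_op_def sum_distrib_right)
  also have "\<dots> = (\<Sum>v\<in>A. \<Sum>u\<in>A. h u v * f v * cnj (g u))" by (rule sum.swap)
  also have "\<dots> = (\<Sum>v\<in>A. \<Sum>u\<in>A. f v * (cnj (h v u) * cnj (g u)))"
  proof (intro sum.cong refl)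
    fix v u assume "v \<in> A" "u \<in> A"
    then have "h u v = cnj (h v u)" by (rule herm[rotated])
    then show "h u v * f v * cnj (g u) = f v * (cnj (h v u) * cnj (g u))" by simp
  qed
  finally show ?thesis by (simp add: mat_op_def sum_distrib_left)
qed

lemma sum_norm_eq_0:
  assumes "(\<Sum>u\<in>A. f u * cnj (f u)) = 0" "u \<in> A" shows "f u = 0"
proof -
  have "complex_of_real (\<Sum>u\<in>A. (cmod (f u))\<^sup>2) = (\<Sum>u\<in>A. f u * cnj (f u))"
    by (simp only: of_real_sum complex_norm_square)
  then have "(\<Sum>u\<in>A. (cmod (f u))\<^sup>2) = 0" using assms(1) by (metis of_real_eq_0_iff)
  then show ?thesis using assms(2) fin by (simp add: sum_nonneg_eq_0_iff)
qed

lemma eigenvalue_real: assumes "is_eigenvalue c" shows "cnj c = c"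
proof -
  obtain f u where f: "u \<in> A" "f u \<noteq> 0" "\<And>u. u \<in> A \<Longrightarrow> T f u = c * f u"
    using assms unfolding is_eigenvalue_def by blast
  have "c * (\<Sum>u\<in>A. f u * cnj (f u)) = cnj c * (\<Sum>u\<in>A. f u * cnj (f u))"
    using self_adjoint[of f f] f(3) by (simp add: sum_distrib_left mult.assoc mult.left_commute)
  moreover have "(\<Sum>u\<in>A. f u * cnj (f u)) \<noteq> 0" using sum_norm_eq_0 f(1,2) by blast
  ultimately show ?thesis by simp
qed

definition shift where "shift c f = (\<lambda>u. T f u - c * f u)"

text \<open>Equations between vectors hold only on \<open>A\<close>, so they cannot be rewritten
  under \<open>shift\<close>; this rule does it instead.\<close>

lemma shift_cong: "(\<And>u. u \<in> A \<Longrightarrow> f u = g u) \<Longrightarrow> u \<in> A \<Longrightarrow> shift c f u = shift c g u"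
  by (auto simp: shift_def mat_op_def intro: sum.cong)

lemma shift_commute: "shift c (shift d f) = shift d (shift c f)"
  by (simp add: shift_def mat_op_diff_scale algebra_simps)

text \<open>For real \<open>c\<close> the operator \<open>T - c\<close> is self-adjoint, so the
  squared norm of \<open>shift c f\<close> is the inner product of
  \<open>shift c (shift c f)\<close> with \<open>f\<close>, which is 0.\<close>

lemma shift_sq_eq_0:
  assumes "\<And>u. u \<in> A \<Longrightarrow> shift c (shift c f) u = 0" "cnj c = c" "u \<in> A"
  shows "shift c f u = 0"
proof (rule sum_norm_eq_0[OF _ assms(3)])
  let ?y = "shift c f"
  have "(\<Sum>u\<in>A. ?y u * cnj (?y u)) = (\<Sum>u\<in>A. ?y u * cnj (T f u)) - c * (\<Sum>u\<in>A. ?y u * cnj (f u))"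
    by (subst (2) shift_def) (simp add: assms(2) right_diff_distrib sum_subtractf sum_distrib_left algebra_simps)
  also have "\<dots> = (\<Sum>u\<in>A. shift c ?y u * cnj (f u))"
    by (subst self_adjoint[symmetric]) (simp add: shift_def[of c ?y] left_diff_distrib sum_subtractf sum_distrib_left algebra_simps)
  finally show "(\<Sum>u\<in>A. ?y u * cnj (?y u)) = 0" using assms(1) by simp
qed

text \<open>Induction on the degree of an annihilating polynomial: splitting off a root \<open>c\<close>, either \<open>c\<close> is an
  eigenvalue, and self-adjointness removes the repeated factor, or \<open>T - c\<close> is injective.\<close>
lemma shift_shift_eq_0:
  assumes ev: "\<And>c. is_eigenvalue c \<Longrightarrow> c = \<theta> \<or> c = \<tau>"
  assumes "p \<noteq> 0" "\<And>u. u \<in> A \<Longrightarrow> (\<Sum>j\<le>degree p. coeff p j * (T ^^ j) x u) = 0" "u \<in> A"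
  shows "shift \<theta> (shift \<tau> x) u = 0"
  using assms(2-)
proof (induction "degree p" arbitrary: p x u)
  case 0
  then have "coeff p 0 \<noteq> 0" by (metis leading_coeff_neq_0)
  then have "x v = 0" if "v \<in> A" for v using 0(3)[OF that] 0(1) by simp
  then show ?case using \<open>u \<in> A\<close> by (simp add: shift_def mat_op_def)
next
  case (Suc m)
  then have "\<not> constant (poly p)" by (metis constant_degree nat.distinct(1))
  then obtain c where "poly p c = 0" using fundamental_theorem_of_algebra by blast
  then obtain q where q: "p = [:- c, 1:] * q" by (metis poly_eq_0_iff_dvd dvdE)
  have q0: "q \<noteq> 0" using q Suc.prems(1) by auto
  have "degree p = degree [:- c, 1:] + degree q" unfolding q by (rule degree_mult_eq) (simp_all add: q0)
  then have dq: "degree q = m" using Suc.hyps(2) by simp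
  have cf: "coeff p j = (if j = 0 then 0 else coeff q (j - 1)) - c * coeff q j" for j
    by (cases j) (simp_all add: q)
  \<comment> \<open>Since \<open>p = (X - c) q\<close>, the polynomial \<open>q\<close> annihilates
    \<open>shift c x\<close>; the induction hypothesis applies to that vector, and the shifts
    commute.\<close>
  have y: "shift c (shift \<theta> (shift \<tau> x)) u = 0" if "u \<in> A" for u
  proof -
    have "(\<Sum>j\<le>degree q. coeff q j * (T ^^ j) (shift c x) u)
       = (\<Sum>j\<le>m. coeff q j * (T ^^ Suc j) x u) - c * (\<Sum>j\<le>m. coeff q j * (T ^^ j) x u)" for u
      by (simp add: dq shift_def mat_op_pow_diff_scale funpow_swap1 right_diff_distrib sum_subtractf
        sum_distrib_left mult.left_commute)
    also have "\<dots> u = (\<Sum>j\<le>degree p. coeff p j * (T ^^ j) x u)" for u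
    proof -
      have "(\<Sum>j\<le>degree p. coeff p j * (T ^^ j) x u)
        = (\<Sum>j\<le>Suc m. (if j = 0 then 0 else coeff q (j - 1)) * (T ^^ j) x u) - c * (\<Sum>j\<le>Suc m. coeff q j * (T ^^ j) x u)"
        unfolding Suc.hyps(2)[symmetric] cf
        by (simp only: left_diff_distrib sum_subtractf sum_distrib_left mult.assoc)
      also have "(\<Sum>j\<le>Suc m. (if j = 0 then 0 else coeff q (j - 1)) * (T ^^ j) x u) = (\<Sum>j\<le>m. coeff q j * (T ^^ Suc j) x u)"
        by (subst sum.atMost_Suc_shift) simp
      also have "(\<Sum>j\<le>Suc m. coeff q j * (T ^^ j) x u) = (\<Sum>j\<le>m. coeff q j * (T ^^ j) x u)"
        using dq by (simp add: coeff_eq_0)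
      finally show ?thesis by simp
    qed
    finally have "shift \<theta> (shift \<tau> (shift c x)) u = 0"
      using Suc.prems(2) that by (intro Suc.hyps(1)[of q]) (simp_all add: dq q0)
    then show ?thesis by (simp add: shift_commute[of c])
  qed
  show ?case
  proof (rule ccontr)
    assume nz: "shift \<theta> (shift \<tau> x) u \<noteq> 0"
    have "is_eigenvalue c" unfolding is_eigenvalue_def
      using y nz \<open>u \<in> A\<close> by (intro exI[of _ "shift \<theta> (shift \<tau> x)"]) (auto simp: shift_def[of c])
    then have r: "cnj c = c" and "c = \<theta> \<or> c = \<tau>" using eigenvalue_real ev by auto
    from this(2) show False
    proof
      assume "c = \<theta>"
      then show False using shift_sq_eq_0[of c "shift \<tau> x"] y r nz \<open>u \<in> A\<close> by simp
    next
      assume "c = \<tau>"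
      then show False using shift_sq_eq_0[of c "shift \<theta> x"] y r nz \<open>u \<in> A\<close>
        by (simp add: shift_commute[of \<theta>])
    qed
  qed
qed

text \<open>The operator \<open>(T - \<theta>)(T - \<tau>)\<close> kills every vector; applied to
  the unit vector \<open>e\<close> at \<open>v\<close> and evaluated at \<open>u\<close>, it gives
  this entry of the matrix equation.\<close>

lemma square_eq_if_two_eigenvalues:
  assumes ev: "\<And>c. is_eigenvalue c \<Longrightarrow> c = \<theta> \<or> c = \<tau>" and "u \<in> A" "v \<in> A"
  shows "(\<Sum>w\<in>A. h u w * h w v) = (\<theta> + \<tau>) * h u v - (if u = v then \<theta> * \<tau> else 0)"
proof -
  define e :: "'a \<Rightarrow> complex" where "e = (\<lambda>w. if w = v then 1 else 0)"
  obtain p where "p \<noteq> 0" "\<forall>u\<in>A. (\<Sum>j\<le>degree p. coeff p j * (T ^^ j) e u) = 0"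
    using annihilating_poly_exists[OF fin] by blast
  then have z: "shift \<theta> (shift \<tau> e) u = 0" using shift_shift_eq_0 ev assms(2) by blast
  have Te: "T e w = h w v" for w
    using fin assms(3) by (simp add: mat_op_def e_def if_distrib[of "(*) _"] cong: if_cong)
  have TTe: "T (\<lambda>w. h w v) u = (\<Sum>w\<in>A. h u w * h w v)" by (simp add: mat_op_def)
  have "e u = (if u = v then 1 else 0)" by (simp add: e_def)
  with z show ?thesis
    by (simp add: shift_def mat_op_diff_scale TTe Te algebra_simps split: if_splits)
qed

text \<open>The equation says \<open>(T - \<theta>)(T - \<tau>) = 0\<close>, so every eigenvalue is
  a root. Both roots occur: the nonzero off-diagonal entry prevents \<open>T\<close> from being
  scalar, so for either root \<open>d\<close> the image of \<open>T - d\<close> is nonzero, and it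
  consists of vectors killed by the other factor.\<close>

lemma eigenvalues_if_square_eq:
  assumes sq: "\<And>u v. \<lbrakk>u \<in> A; v \<in> A\<rbrakk> \<Longrightarrow>
      (\<Sum>w\<in>A. h u w * h w v) = (\<theta> + \<tau>) * h u v - (if u = v then \<theta> * \<tau> else 0)"
    and off: "u\<^sub>0 \<in> A" "v\<^sub>0 \<in> A" "u\<^sub>0 \<noteq> v\<^sub>0" "h u\<^sub>0 v\<^sub>0 \<noteq> 0"
  shows "{c. is_eigenvalue c} = {\<theta>, \<tau>}"
proof -
  have ss: "shift \<theta> (shift \<tau> f) u = 0" if "u \<in> A" for f u
  proof -
    have "T (T f) u = (\<Sum>w\<in>A. \<Sum>v\<in>A. h u w * h w v * f v)"
      by (simp add: mat_op_def sum_distrib_left mult.assoc)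
    also have "\<dots> = (\<Sum>v\<in>A. (\<Sum>w\<in>A. h u w * h w v) * f v)"
      by (subst sum.swap) (simp add: sum_distrib_right)
    also have "\<dots> = (\<Sum>v\<in>A. (\<theta> + \<tau>) * (h u v * f v) - (if u = v then \<theta> * \<tau> * f v else 0))"
      by (intro sum.cong refl) (simp add: sq[OF that] left_diff_distrib mult.assoc)
    also have "\<dots> = (\<theta> + \<tau>) * T f u - \<theta> * \<tau> * f u"
      using that fin by (simp add: sum_subtractf mat_op_def sum_distrib_left)
    finally show ?thesis by (simp add: shift_def mat_op_diff_scale algebra_simps)
  qed
  have "is_eigenvalue c" if "{c, d} = {\<theta>, \<tau>}" for c d
  proof -
    let ?f = "shift d (\<lambda>w. if w = v\<^sub>0 then 1 else 0)"
    have "shift c ?f u = 0" if "u \<in> A" for u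
      using \<open>{c, d} = {\<theta>, \<tau>}\<close> ss[OF that] shift_commute[of c d] by (auto simp: doubleton_eq_iff)
    then have "T ?f u = c * ?f u" if "u \<in> A" for u using that by (simp add: shift_def[of c])
    moreover have "?f u\<^sub>0 \<noteq> 0" using off fin
      by (simp add: shift_def mat_op_def if_distrib[of "(*) _"] cong: if_cong)
    ultimately show ?thesis unfolding is_eigenvalue_def using off(1) by blast
  qed
  then have "is_eigenvalue \<theta>" "is_eigenvalue \<tau>" by blast+
  moreover have "c = \<theta> \<or> c = \<tau>" if c: "is_eigenvalue c" for c
  proof -
    obtain f u where f: "u \<in> A" "f u \<noteq> 0" "\<And>u. u \<in> A \<Longrightarrow> T f u = c * f u"
      using c unfolding is_eigenvalue_def by blast
    have *: "shift \<tau> f w = (c - \<tau>) * f w" if "w \<in> A" for w using f(3)[OF that]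
      by (simp add: shift_def algebra_simps)
    have "shift \<theta> (shift \<tau> f) u = shift \<theta> (\<lambda>w. (c - \<tau>) * f w) u"
      using f(1) by (intro shift_cong) (auto simp: *)
    also have "\<dots> = (c - \<tau>) * (c - \<theta>) * f u"
    proof -
      have "T (\<lambda>w. (c - \<tau>) * f w) u = (c - \<tau>) * T f u"
        by (simp add: mat_op_def sum_distrib_left mult.left_commute)
      then show ?thesis using f(1,3) by (simp add: shift_def algebra_simps)
    qed
    finally show ?thesis using ss[OF f(1)] f(2) by auto
  qed
  ultimately show ?thesis by auto
qed

end

section \<open>The arc equation\<close>

lemma omega_eq: "omega = Complex (1/2) (sqrt 3 / 2)"
  by (simp add: omega_def complex_eq_iff)

lemma Re_omega [simp]: "Re omega = 1/2" and Im_omega [simp]: "Im omega = sqrt 3 / 2"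
  by (simp_all add: omega_eq)

locale two_eigenvalue_graph = oriented_graph D for D :: "'a pair_pre_digraph" +
  fixes a k :: real
  assumes H_square: "\<lbrakk>u \<in> pverts D; v \<in> pverts D\<rbrakk> \<Longrightarrow>
      (\<Sum>w\<in>pverts D. H_entry D u w * H_entry D w v)
        = complex_of_real a * H_entry D u v + (if u = v then complex_of_real k else 0)"
    and arcs_nonempty: "parcs D \<noteq> {}"
    and conn: "connected D"
begin

abbreviation VD where "VD \<equiv> pverts D"
abbreviation A where "A \<equiv> parcs D"

definition M :: "'a \<Rightarrow> 'a \<Rightarrow> real" where "M u v = of_bool ((u, v) \<in> A)"

lemma fin_V: "finite VD" by (rule pair_finite_verts)

lemma no_loop: "(u, u) \<notin> A" using pair_no_loops by fastforce

lemma M_simps [simp]: "M u u = 0" "M u v * M v u = 0" "M u v * M u v = M u v" "M u v \<ge> 0"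
  using asym_arcs no_loop by (auto simp: M_def)

lemma H_entry_M: "H_entry D u v = omega * of_real (M u v) + cnj omega * of_real (M v u)"
  using asym_arcs by (auto simp: M_def H_entry_def)

definition walks :: "'a \<Rightarrow> 'a \<Rightarrow> real" where
  "walks u v = (\<Sum>w\<in>VD. M u w * M w v)"

text \<open>The entries of \<open>M M' + M' M\<close>: common out-neighbours plus common
  in-neighbours.\<close>

definition hinges :: "'a \<Rightarrow> 'a \<Rightarrow> real" where
  "hinges u v = (\<Sum>w\<in>VD. M u w * M v w + M w u * M w v)"

definition outdeg where "outdeg u = (\<Sum>w\<in>VD. M u w)"
definition indeg where "indeg u = (\<Sum>w\<in>VD. M w u)"

lemma hinges_commute: "hinges u v = hinges v u"
  by (simp add: hinges_def mult.commute)

text \<open>In the entry of the square, a hinge contributes \<open>omega * cnj omega = 1\<close>,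
  and a walk from \<open>u\<close> to \<open>v\<close> or back contributes
  \<open>omega * omega\<close> or its conjugate, with real part -1/2. The real part of
  \<open>H_square\<close> is therefore symmetric in \<open>u\<close>, \<open>v\<close> and the
  imaginary part antisymmetric; combining them isolates \<open>walks u v\<close>.\<close>

lemma arc_equation:
  assumes "u \<in> VD" "v \<in> VD"
  shows "walks u v + a * M v u = hinges u v - (if u = v then k else 0)"
proof -
  let ?S = "\<Sum>w\<in>VD. H_entry D u w * H_entry D w v"
  have s3: "sqrt 3 * (sqrt 3 * x) = 3 * x" for x by (simp add: mult.assoc[symmetric])
  have Re: "Re (H_entry D u w * H_entry D w v) =
      (M u w * M v w + M w u * M w v) - (M u w * M w v + M v w * M w u) / 2" for w
    by (simp add: H_entry_M algebra_simps s3 add_divide_distrib)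
  have Im: "Im (H_entry D u w * H_entry D w v) = sqrt 3 / 2 * (M u w * M w v - M v w * M w u)" for w
    by (simp add: H_entry_M field_simps)
  have "hinges u v - (walks u v + walks v u) / 2 = Re ?S"
    unfolding Re_sum Re by (simp add: sum_subtractf sum.distrib hinges_def walks_def sum_divide_distrib add_divide_distrib)
  also have "\<dots> = a * (M u v + M v u) / 2 + (if u = v then k else 0)"
    unfolding H_square[OF assms] by (simp add: H_entry_M field_simps)
  finally have re: "hinges u v - (walks u v + walks v u) / 2 = a * (M u v + M v u) / 2 + (if u = v then k else 0)" .
  have "sqrt 3 / 2 * (walks u v - walks v u) = Im ?S"
    unfolding Im_sum Im by (simp add: sum_subtractf walks_def sum_distrib_left right_diff_distrib)
  also have "\<dots> = sqrt 3 / 2 * (a * (M u v - M v u))"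
    unfolding H_square[OF assms] by (simp add: H_entry_M field_simps)
  finally have "walks u v - walks v u = a * (M u v - M v u)" by (simp only: mult_cancel_left) simp
  with re show ?thesis by (simp add: field_simps)
qed

lemma out_plus_in: assumes "u \<in> VD" shows "outdeg u + indeg u = k"
proof -
  have "walks u u = 0" by (simp add: walks_def)
  moreover have "hinges u u = outdeg u + indeg u"
    by (simp add: hinges_def outdeg_def indeg_def sum.distrib)
  ultimately show ?thesis using arc_equation[OF assms assms] by simp
qed

text \<open>Multiplied by \<open>M\<close> entrywise and summed, the arc equation becomes \<open>T = 2 T\<close> for the number \<open>T\<close> of
  transitive triangles, since two of the three arcs of such a triangle are closed by a hinge and one
  by a walk.\<close>
lemma no_transitive_triangle:
  assumes "(u, w) \<in> A" "(w, v) \<in> A" shows "(u, v) \<notin> A"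
proof
  assume uv: "(u, v) \<in> A"
  define t where "t = (\<lambda>x y z. M x z * M x y * M y z)"
  define T where "T = (\<Sum>x\<in>VD. \<Sum>z\<in>VD. \<Sum>y\<in>VD. t x y z)"
  \<comment> \<open>An arc from \<open>x\<close> to \<open>z\<close> excludes both
    \<open>x = z\<close> and the reverse arc, so the terms with \<open>a\<close> and
    \<open>k\<close> drop out.\<close>
  have wh: "M x z * walks x z = M x z * hinges x z" if "x \<in> VD" "z \<in> VD" for x z
  proof -
    have "M x z * (walks x z + a * M z x) = M x z * (hinges x z - (if x = z then k else 0))"
      using arc_equation[OF that] by simp
    then show ?thesis by (simp add: algebra_simps split: if_splits)
  qed
  have "T = (\<Sum>x\<in>VD. \<Sum>z\<in>VD. M x z * walks x z)"
    by (simp add: T_def t_def walks_def sum_distrib_left mult.assoc)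
  also have "\<dots> = (\<Sum>x\<in>VD. \<Sum>z\<in>VD. M x z * hinges x z)"
    by (intro sum.cong refl wh)
  \<comment> \<open>Together with the arc from \<open>x\<close> to \<open>z\<close>, a common
    out-neighbour \<open>y\<close> gives the transitive triangle \<open>t x z y\<close>, and a
    common in-neighbour gives \<open>t y x z\<close>. Renaming turns each of the two sums into
    \<open>T\<close>.\<close>
  also have "\<dots> = (\<Sum>x\<in>VD. \<Sum>z\<in>VD. \<Sum>y\<in>VD. t x z y) + (\<Sum>x\<in>VD. \<Sum>z\<in>VD. \<Sum>y\<in>VD. t y x z)"
    by (simp add: hinges_def t_def sum.distrib sum_distrib_left distrib_left mult_ac)
  also have "(\<Sum>x\<in>VD. \<Sum>z\<in>VD. \<Sum>y\<in>VD. t x z y) = T"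
    unfolding T_def by (intro sum.cong refl sum.swap)
  also have "(\<Sum>x\<in>VD. \<Sum>z\<in>VD. \<Sum>y\<in>VD. t y x z) = (\<Sum>x\<in>VD. \<Sum>y\<in>VD. \<Sum>z\<in>VD. t y x z)"
    by (intro sum.cong refl sum.swap)
  also have "\<dots> = (\<Sum>y\<in>VD. \<Sum>x\<in>VD. \<Sum>z\<in>VD. t y x z)" by (rule sum.swap)
  also have "\<dots> = T" unfolding T_def by (intro sum.cong refl sum.swap)
  finally have "T = 0" by simp
  moreover have "t x y z \<ge> 0" for x y z by (simp add: t_def)
  ultimately have "t u w v = 0"
    using fin_V in_arcsD1[OF uv] in_arcsD2[OF uv] in_arcsD1[OF assms(2)]
    by (simp add: T_def sum_nonneg_eq_0_iff sum_nonneg)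
  then show False using assms uv by (simp add: t_def M_def)
qed

text \<open>Sum the arc equation over all pairs and sort by middle vertex \<open>w\<close>: walks
  contribute \<open>indeg w * outdeg w\<close>, hinges
  \<open>(indeg w)\<^sup>2 + (outdeg w)\<^sup>2\<close>. Substituting
  \<open>indeg = k - outdeg\<close> leaves one linear relation between the number of arcs
  \<open>e\<close> and the sum \<open>S\<close> of squared out-degrees, namely
  \<open>3 * S = (k + a + 2) * e\<close>.\<close>

lemma outdeg_variance: "(\<Sum>u\<in>VD. (2 * outdeg u - k)\<^sup>2) = k * card VD / 3 * (4 + 2 * a - k)"
proof -
  define e where "e = (\<Sum>u\<in>VD. outdeg u)"
  define S where "S = (\<Sum>u\<in>VD. (outdeg u)\<^sup>2)"
  let ?n = "real (card VD)"
  have ind: "indeg u = k - outdeg u" if "u \<in> VD" for u using out_plus_in[OF that] by simp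
  have in_sum: "(\<Sum>u\<in>VD. indeg u) = e"
    unfolding e_def indeg_def outdeg_def by (rule sum.swap)
  moreover have "(\<Sum>u\<in>VD. indeg u) = ?n * k - e" by (simp add: ind sum_subtractf e_def)
  ultimately have nk: "?n * k = 2 * e" by simp
  have "(\<Sum>u\<in>VD. \<Sum>v\<in>VD. walks u v) = (\<Sum>w\<in>VD. \<Sum>u\<in>VD. \<Sum>v\<in>VD. M u w * M w v)"
    unfolding walks_def by (subst sum.swap[of _ VD VD], subst (2) sum.swap) (intro sum.cong refl sum.swap)
  also have "\<dots> = (\<Sum>w\<in>VD. indeg w * outdeg w)"
    by (simp add: indeg_def outdeg_def sum_product)
  also have "\<dots> = k * e - S"
    by (simp add: ind left_diff_distrib sum_subtractf e_def S_def sum_distrib_left power2_eq_square)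
  finally have w: "(\<Sum>u\<in>VD. \<Sum>v\<in>VD. walks u v) = k * e - S" .
  have "(\<Sum>u\<in>VD. \<Sum>v\<in>VD. hinges u v) = (\<Sum>u\<in>VD. \<Sum>w\<in>VD. \<Sum>v\<in>VD. M u w * M v w + M w u * M w v)"
    unfolding hinges_def by (intro sum.cong refl sum.swap)
  also have "\<dots> = (\<Sum>w\<in>VD. \<Sum>u\<in>VD. \<Sum>v\<in>VD. M u w * M v w + M w u * M w v)" by (rule sum.swap)
  also have "\<dots> = (\<Sum>w\<in>VD. (indeg w)\<^sup>2 + (outdeg w)\<^sup>2)"
    by (simp add: indeg_def outdeg_def power2_eq_square sum_product sum.distrib)
  also have "\<dots> = (\<Sum>w\<in>VD. 2 * (outdeg w)\<^sup>2 - 2 * k * outdeg w + k\<^sup>2)"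
    by (intro sum.cong refl) (simp add: ind power2_eq_square algebra_simps)
  also have "\<dots> = 2 * S - 2 * k * e + ?n * k\<^sup>2"
    by (simp add: sum.distrib sum_subtractf S_def e_def sum_distrib_left)
  finally have h: "(\<Sum>u\<in>VD. \<Sum>v\<in>VD. hinges u v) = 2 * S - 2 * k * e + ?n * k\<^sup>2" .
  have "(\<Sum>u\<in>VD. \<Sum>v\<in>VD. walks u v + a * M v u) = (\<Sum>u\<in>VD. \<Sum>v\<in>VD. hinges u v - (if u = v then k else 0))"
    by (intro sum.cong refl arc_equation)
  then have "k * e - S + a * e = 2 * S - 2 * k * e + ?n * k\<^sup>2 - ?n * k"
    using in_sum fin_V by (simp add: sum.distrib sum_subtractf w h sum_distrib_left[symmetric] indeg_def)
  moreover have "?n * k\<^sup>2 = 2 * e * k" using nk by (simp add: power2_eq_square)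
  ultimately have S3: "3 * S = (k + a + 2) * e" using nk by (simp add: algebra_simps)
  have "(\<Sum>u\<in>VD. (2 * outdeg u - k)\<^sup>2) = (\<Sum>u\<in>VD. 4 * (outdeg u)\<^sup>2 - 4 * k * outdeg u + k\<^sup>2)"
    by (intro sum.cong refl) (simp add: power2_eq_square algebra_simps)
  also have "\<dots> = 4 * S - 4 * k * e + ?n * k\<^sup>2"
    by (simp add: sum.distrib sum_subtractf S_def e_def sum_distrib_left)
  also have "\<dots> = 2 * e / 3 * (4 + 2 * a - k)"
    using S3 \<open>?n * k\<^sup>2 = 2 * e * k\<close> by (simp add: field_simps)
  finally show ?thesis unfolding nk[symmetric] by (simp only: mult.commute)
qed

section \<open>Neighbourhoods, the bound on the degree, and a criterion for isomorphism\<close>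

lemma card_V_pos: "card VD > 0"
  using arcs_nonempty fin_V in_arcsD1 by (auto simp: card_gt_0_iff)

definition N where "N u = {w. (u, w) \<in> A \<or> (w, u) \<in> A}"

lemma N_sub: "N u \<subseteq> VD" using in_arcsD1 in_arcsD2 by (auto simp: N_def)
lemma fin_N: "finite (N u)" using N_sub fin_V by (rule finite_subset)

lemma card_eq_sum: assumes "S \<subseteq> VD" shows "real (card S) = (\<Sum>w\<in>VD. of_bool (w \<in> S))"
proof -
  have "(\<Sum>w\<in>VD. of_bool (w \<in> S) :: real) = real (card (VD \<inter> S))"
    using fin_V by (simp add: sum.If_cases of_bool_def Int_def)
  then show ?thesis using assms by (simp add: Int_absorb1)
qed

lemma card_N: assumes "u \<in> VD" shows "real (card (N u)) = k"
proof -
  have "real (card (N u)) = (\<Sum>w\<in>VD. M u w + M w u)"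
    unfolding card_eq_sum[OF N_sub] using asym_arcs
    by (intro sum.cong) (auto simp: N_def M_def)
  then show ?thesis using out_plus_in[OF assms] by (simp add: outdeg_def indeg_def sum.distrib)
qed

lemma card_out: "real (card {w. (u, w) \<in> A}) = outdeg u"
  using in_arcsD2 by (subst card_eq_sum) (auto simp: outdeg_def M_def)

lemma card_arcs: "2 * real (card A) = k * card VD"
proof -
  have "A = (SIGMA u:VD. {w. (u, w) \<in> A})" using in_arcsD1 by auto
  moreover have "finite {w. (u, w) \<in> A}" for u by (rule finite_subset[OF _ fin_N[of u]]) (auto simp: N_def)
  ultimately have "card A = (\<Sum>u\<in>VD. card {w. (u, w) \<in> A})"
    using card_SigmaI[OF fin_V, of "\<lambda>u. {w. (u, w) \<in> A}"] by simp
  then have "real (card A) = (\<Sum>u\<in>VD. outdeg u)" by (simp add: card_out)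
  moreover have "(\<Sum>u\<in>VD. outdeg u) = (\<Sum>u\<in>VD. indeg u)"
    unfolding indeg_def outdeg_def by (rule sum.swap)
  ultimately have "2 * real (card A) = (\<Sum>u\<in>VD. outdeg u + indeg u)" by (simp add: sum.distrib)
  then show ?thesis using out_plus_in by simp
qed

lemma card_walks: "real (card {w. (u, w) \<in> A \<and> (w, v) \<in> A}) = walks u v"
proof -
  have "{w. (u, w) \<in> A \<and> (w, v) \<in> A} \<subseteq> VD" using in_arcsD2 by auto
  from card_eq_sum[OF this] show ?thesis
    unfolding walks_def by (simp only:) (intro sum.cong, auto simp: M_def)
qed

lemma card_common: "real (card (N u \<inter> N v)) = hinges u v + walks u v + walks v u"
proof -
  have "N u \<inter> N v \<subseteq> VD" using N_sub by blast
  then have "real (card (N u \<inter> N v)) = (\<Sum>w\<in>VD. M u w * M v w + M w u * M w v + M u w * M w v + M v w * M w u)"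
    unfolding card_eq_sum[OF \<open>N u \<inter> N v \<subseteq> VD\<close>] using asym_arcs
    by (intro sum.cong refl) (auto simp: N_def M_def)
  then show ?thesis by (simp add: hinges_def walks_def sum.distrib)
qed

text \<open>The arc equation is used in both directions. For \<open>(u, v)\<close> there is no walk,
  as it would close a transitive triangle, and hence no hinge; for \<open>(v, u)\<close> this leaves
  \<open>walks v u = - a\<close>.\<close>

lemma arc_common:
  assumes "(u, v) \<in> A"
  shows "real (card {w. (v, w) \<in> A \<and> (w, u) \<in> A}) = - a"
proof -
  have VD: "u \<in> VD" "v \<in> VD" "u \<noteq> v" using assms in_arcsD1 in_arcsD2 no_loop by auto
  have "{w. (u, w) \<in> A \<and> (w, v) \<in> A} = {}" using no_transitive_triangle assms by blast
  then have "walks u v = 0" by (metis card_walks card.empty of_nat_0)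
  then have "hinges v u = 0" using arc_equation[OF VD(1,2)] VD(3) assms asym_arcs[OF assms]
    by (simp add: hinges_commute M_def)
  then show ?thesis using arc_equation[OF VD(2,1)] VD(3) assms by (simp add: card_walks M_def)
qed

text \<open>The upper bound holds because the sum of squares in \<open>outdeg_variance\<close> is
  nonnegative; the lower one because an arc gives some vertex a neighbour.\<close>

lemma k_bound: "1 \<le> k" "k \<le> 4 + 2 * a"
proof -
  obtain u v where uv: "(u, v) \<in> A" using arcs_nonempty by auto
  have "v \<in> N u" using uv by (simp add: N_def)
  then have "card (N u) \<ge> 1" using fin_N by (metis card_0_eq empty_iff less_one not_le)
  then show k: "1 \<le> k" using card_N[of u] uv in_arcsD1 by fastforce
  have "0 \<le> k * card VD / 3 * (4 + 2 * a - k)"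
    unfolding outdeg_variance[symmetric] by (simp add: sum_nonneg)
  then show "k \<le> 4 + 2 * a" using k card_V_pos
    by (simp only: zero_le_mult_iff divide_le_0_iff) (auto simp: mult_le_0_iff zero_le_mult_iff)
qed

text \<open>By connectedness every vertex is reached from \<open>C\<close> through successive
  neighbours. This determines the vertex set once the neighbourhoods of a few named vertices are
  known.\<close>

lemma closed_eq_V:
  assumes "C \<subseteq> VD" "C \<noteq> {}" "\<And>u. u \<in> C \<Longrightarrow> N u \<subseteq> C"
  shows "VD = C"
proof
  obtain u where u: "u \<in> C" using assms(2) by blast
  show "VD \<subseteq> C"
  proof
    fix v assume v: "v \<in> VD"
    have "u \<rightarrow>\<^sup>*\<^bsub>mk_symmetric D\<^esub> v"
      using conn u v assms(1) unfolding connected_def strongly_connected_def by auto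
    then have "(u, v) \<in> (parcs (mk_symmetric D))\<^sup>*" using reachable_rtranclI by fastforce
    then show "v \<in> C"
    proof (induction rule: rtrancl_induct)
      case base then show ?case using u by simp
    next
      case (step x y)
      then show ?case using assms(3)[of x] by (auto simp: N_def parcs_mk_symmetric)
    qed
  qed
qed (rule assms(1))

text \<open>It is enough that \<open>g\<close> maps arcs to arcs: the induced map on arcs is
  injective, and by \<open>card_arcs\<close> both graphs have equally many arcs, so it is
  onto.\<close>

lemma iso_if_arcs_preserved:
  fixes g :: "'b \<Rightarrow> 'a" and D' :: "'b pair_pre_digraph"
  assumes g: "inj_on g (pverts D')" and fin: "finite (pverts D')"
    and VD: "VD = g ` pverts D'"
    and wf: "parcs D' \<subseteq> pverts D' \<times> pverts D'"
    and arcs: "\<And>x y. (x, y) \<in> parcs D' \<Longrightarrow> (g x, g y) \<in> A"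
    and card: "2 * real (card (parcs D')) = k * card (pverts D')"
  shows "digraph_iso D D'"
proof -
  \<comment> \<open>The isomorphism has to start from \<open>D\<close>, whereas \<open>g\<close>
    maps into \<open>D\<close>.\<close>
  let ?f = "the_inv_into (pverts D') g"
  let ?h = "\<lparr>iso_verts = ?f, iso_arcs = map_prod ?f ?f, iso_head = snd, iso_tail = fst\<rparr>"
  have gf: "?f (g x) = x" if "x \<in> pverts D'" for x using that g by (simp add: the_inv_into_f_f)
  have injf: "inj_on ?f VD" unfolding VD by (rule inj_on_the_inv_into[OF g])
  have sub: "map_prod g g ` parcs D' \<subseteq> A" using arcs by auto
  have "inj_on (map_prod g g) (parcs D')"
    using inj_on_subset[OF map_prod_inj_on[OF g g] wf] .
  then have "card (map_prod g g ` parcs D') = card (parcs D')" by (rule card_image)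
  moreover have "card VD = card (pverts D')" unfolding VD by (rule card_image[OF g])
  ultimately have "card (map_prod g g ` parcs D') = card A" using card card_arcs by simp
  then have A: "A = map_prod g g ` parcs D'" using card_subset_eq[OF pair_finite_arcs sub] by simp
  have "A \<subseteq> VD \<times> VD" using in_arcsD1 in_arcsD2 by auto
  then have injA: "inj_on (map_prod ?f ?f) A"
    by (rule inj_on_subset[OF map_prod_inj_on[OF injf injf]])
  have fA: "map_prod ?f ?f ` A = parcs D'"
  proof -
    have "map_prod ?f ?f (map_prod g g z) = z" if z: "z \<in> parcs D'" for z
      using wf z gf by (cases z) auto
    then show ?thesis unfolding A image_image by simp
  qed
  have fV: "?f ` VD = pverts D'" unfolding VD image_image using gf by simp
  have "digraph_isomorphism ?h"
    unfolding digraph_isomorphism_def using injf injA wf_digraph_axioms by auto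
  moreover have "with_proj D' = app_iso ?h (with_proj D)"
    by (simp add: app_iso_def with_proj_def fA fV)
  ultimately show ?thesis unfolding digraph_iso_def by blast
qed

end

section \<open>Small degrees\<close>

lemma card_ge_imp_eq:
  assumes "finite S" "set xs \<subseteq> S" "distinct xs" "card S \<le> length xs"
  shows "S = set xs"
  using card_subset_eq[OF assms(1,2)] assms card_mono[OF assms(1,2)] by (simp add: distinct_card)

lemma three_of_four:
  assumes "distinct [a, b, c, d]" "card ({a, b, c, d} \<inter> S) = 3" "a \<notin> S"
  shows "b \<in> S" "c \<in> S" "d \<in> S"
proof -
  have "{b, c, d} \<inter> S = {a, b, c, d} \<inter> S" using assms(3) by auto
  then have "card ({b, c, d} \<inter> S) = card {b, c, d}" using assms by simp
  then have "{b, c, d} \<inter> S = {b, c, d}" by (intro card_subset_eq) auto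
  then show "b \<in> S" "c \<in> S" "d \<in> S" by blast+
qed

text \<open>Turns bounded unique existence into a propositional formula, for the case analysis in
  \<open>five_cycle\<close>.\<close>

lemma ex1_less_5:
  assumes "\<exists>!k. k < (5::nat) \<and> P k"
  shows "(P 0 \<and> \<not> P 1 \<and> \<not> P 2 \<and> \<not> P 3 \<and> \<not> P 4) \<or> (\<not> P 0 \<and> P 1 \<and> \<not> P 2 \<and> \<not> P 3 \<and> \<not> P 4) \<or>
    (\<not> P 0 \<and> \<not> P 1 \<and> P 2 \<and> \<not> P 3 \<and> \<not> P 4) \<or> (\<not> P 0 \<and> \<not> P 1 \<and> \<not> P 2 \<and> P 3 \<and> \<not> P 4) \<or>
    (\<not> P 0 \<and> \<not> P 1 \<and> \<not> P 2 \<and> \<not> P 3 \<and> P 4)"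
proof -
  obtain k where k: "k < 5" "P k" "\<And>y. y < 5 \<Longrightarrow> P y \<Longrightarrow> y = k" using assms by blast
  have "k = 0 \<or> k = 1 \<or> k = 2 \<or> k = 3 \<or> k = 4" using k(1) by linarith
  then show ?thesis using k(2) k(3)[of 0] k(3)[of 1] k(3)[of 2] k(3)[of 3] k(3)[of 4]
    by (elim disjE; simp; blast)
qed

text \<open>In the application \<open>r i k\<close> says that \<open>p i\<close> points to
  \<open>q k\<close>. Off the diagonal only two tables satisfy the constraints: the adjacency
  relations of the cycles 0-1-3-4-2-0 and 0-1-4-3-2-0, which differ by exchanging 3 and 4.\<close>

lemma five_cycle:
  fixes r :: "nat \<Rightarrow> nat \<Rightarrow> bool"
  assumes ex1: "\<And>i j. \<lbrakk>i < 5; j < 5; i \<noteq> j\<rbrakk> \<Longrightarrow> \<exists>!k. k < 5 \<and> k \<noteq> i \<and> k \<noteq> j \<and> r i k \<and> \<not> r j k"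
    and r0: "r 0 1" "r 0 2" "\<not> r 0 3" "\<not> r 0 4"
  shows "(r 1 0 \<and> \<not> r 1 2 \<and> r 1 3 \<and> \<not> r 1 4 \<and> r 2 0 \<and> \<not> r 2 1 \<and> \<not> r 2 3 \<and> r 2 4 \<and>
      \<not> r 3 0 \<and> r 3 1 \<and> \<not> r 3 2 \<and> r 3 4 \<and> \<not> r 4 0 \<and> \<not> r 4 1 \<and> r 4 2 \<and> r 4 3) \<or>
    (r 1 0 \<and> \<not> r 1 2 \<and> \<not> r 1 3 \<and> r 1 4 \<and> r 2 0 \<and> \<not> r 2 1 \<and> r 2 3 \<and> \<not> r 2 4 \<and>
      \<not> r 3 0 \<and> \<not> r 3 1 \<and> r 3 2 \<and> r 3 4 \<and> \<not> r 4 0 \<and> r 4 1 \<and> \<not> r 4 2 \<and> r 4 3)"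
proof -
  note e = ex1[THEN ex1_less_5]
  note facts = e[of 0 1, simplified] e[of 0 2, simplified] e[of 0 3, simplified] e[of 0 4, simplified]
    e[of 1 0, simplified] e[of 1 2, simplified] e[of 1 3, simplified] e[of 1 4, simplified]
    e[of 2 0, simplified] e[of 2 1, simplified] e[of 2 3, simplified] e[of 2 4, simplified]
    e[of 3 0, simplified] e[of 3 1, simplified] e[of 3 2, simplified] e[of 3 4, simplified]
    e[of 4 0, simplified] e[of 4 1, simplified] e[of 4 2, simplified] e[of 4 3, simplified]
  \<comment> \<open>The simplified facts contain \<open>Suc 0\<close> for 1; unfolding
    \<open>One_nat_def\<close> makes all atoms agree for the propositional search.\<close>
  show ?thesis using facts r0 by (simp only: One_nat_def) argo
qed

section \<open>Common neighbours, and the cases of degree at most three\<close>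

context two_eigenvalue_graph
begin

lemma N_sym: "v \<in> N u \<longleftrightarrow> u \<in> N v" by (auto simp: N_def)
lemma N_irrefl: "u \<notin> N u" using no_loop by (auto simp: N_def)
lemma N_in_VD: "v \<in> N u \<Longrightarrow> u \<in> VD \<and> v \<in> VD" using N_sub N_sym by blast

text \<open>For \<open>a = 0\<close> the arc equation read both ways gives
  \<open>walks u v = hinges u v = walks v u\<close>, so the common neighbours split into three
  classes of equal size.\<close>

lemma common_zero:
  assumes "a = 0" "u \<in> VD" "v \<in> VD" "u \<noteq> v"
  shows "card (N u \<inter> N v) = 3 * card {w. (u, w) \<in> A \<and> (w, v) \<in> A}"
proof -
  have "real (card (N u \<inter> N v)) = 3 * walks u v"
    using arc_equation[of u v] arc_equation[of v u] assms
    by (simp add: card_common hinges_commute[of v u])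
  then show ?thesis using card_walks[of u v] by linarith
qed

text \<open>Along an arc there is no parallel walk, since transitive triangles are excluded;
  \<open>common_zero\<close> then rules out every common neighbour, hence directed triangles
  too.\<close>

lemma triangle_free:
  assumes "a = 0" "v \<in> N u" shows "N u \<inter> N v = {}"
proof -
  have *: "N u \<inter> N v = {}" if "(u, v) \<in> A" for u v
  proof -
    have "{w. (u, w) \<in> A \<and> (w, v) \<in> A} = {}" using no_transitive_triangle that by blast
    then have "card (N u \<inter> N v) = 0"
      using common_zero[OF assms(1), of u v] that in_arcsD1 in_arcsD2 no_loop by (metis card.empty mult_0_right)
    then show ?thesis using fin_N by simp
  qed
  show ?thesis using assms(2) *[of u v] *[of v u] by (auto simp: N_def)
qed

text \<open>The number of common neighbours is a positive multiple of 3 and at most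
  \<open>k \<le> 4\<close>.\<close>

lemma common_three:
  assumes "a = 0" "x \<in> N u" "x \<in> N v" "u \<noteq> v"
  shows "card (N u \<inter> N v) = 3" "\<exists>!w. (u, w) \<in> A \<and> (w, v) \<in> A"
proof -
  let ?c = "card {w. (u, w) \<in> A \<and> (w, v) \<in> A}"
  have V: "u \<in> VD" "v \<in> VD" using N_in_VD assms by blast+
  have c: "card (N u \<inter> N v) = 3 * ?c" by (rule common_zero[OF assms(1) V assms(4)])
  have "card (N u \<inter> N v) \<le> card (N u)" using fin_N by (intro card_mono) auto
  also have "card (N u) \<le> 4" using card_N[OF V(1)] k_bound(2) assms(1) by simp
  finally have "card (N u \<inter> N v) \<le> 4" .
  moreover have "card (N u \<inter> N v) > 0" using assms fin_N by (auto simp: card_gt_0_iff)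
  ultimately have "?c = 1" using c by linarith
  then show "card (N u \<inter> N v) = 3" using c by simp
  obtain x where "{w. (u, w) \<in> A \<and> (w, v) \<in> A} = {x}"
    using \<open>?c = 1\<close> by (auto simp: card_1_singleton_iff)
  then have "(u, w) \<in> A \<and> (w, v) \<in> A \<longleftrightarrow> w = x" for w by (simp add: set_eq_iff)
  then show "\<exists>!w. (u, w) \<in> A \<and> (w, v) \<in> A" by simp
qed

text \<open>Let \<open>m = - a\<close> be the number of directed triangles on an arc. Then
  \<open>1 \<le> k \<le> 4 - 2 m\<close> forces \<open>m = 1\<close> and \<open>k \<le> 2\<close>,
  so the vertices of one triangle have no neighbours outside it.\<close>

lemma iso_triangle: assumes "a \<noteq> 0" shows "digraph_iso D directed_triangle"
proof -
  obtain u v where uv: "(u, v) \<in> A" using arcs_nonempty by auto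
  define m where "m = card {w. (v, w) \<in> A \<and> (w, u) \<in> A}"
  have am: "a = - real m" using arc_common[OF uv] by (simp add: m_def)
  then have "m \<ge> 1" using assms by (cases m) auto
  have "1 \<le> 4 - 2 * real m" using k_bound am by linarith
  then have "m = 1" using \<open>m \<ge> 1\<close> by linarith
  then have k2: "k \<le> 2" using k_bound am by simp
  obtain w where w: "(v, w) \<in> A" "(w, u) \<in> A" using \<open>m = 1\<close> unfolding m_def
    by (metis (no_types, lifting) card_1_singletonE insertI1 mem_Collect_eq)
  have d: "u \<noteq> v" "v \<noteq> w" "w \<noteq> u" using uv w no_loop by auto
  have V: "u \<in> VD" "v \<in> VD" "w \<in> VD" using uv w in_arcsD1 by blast+
  have c2: "card (N x) \<le> Suc (Suc 0)" if "x \<in> VD" for x using card_N[OF that] k2 by simp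
  have N: "N u = {v, w}" "N v = {u, w}" "N w = {u, v}"
    using card_ge_imp_eq[OF fin_N, of "[v, w]" u] card_ge_imp_eq[OF fin_N, of "[u, w]" v]
      card_ge_imp_eq[OF fin_N, of "[u, v]" w] c2 V d uv w by (simp_all add: N_def)
  have VD: "VD = {u, v, w}" by (rule closed_eq_V) (use V N in auto)
  have "k = 2" using card_N[OF V(1)] N(1) d by simp
  define g where "g = (\<lambda>n::nat. if n = 0 then u else if n = 1 then v else w)"
  show ?thesis
    by (rule iso_if_arcs_preserved[of g])
      (use d VD uv w \<open>k = 2\<close> in \<open>auto simp: g_def directed_triangle_def inj_on_def\<close>)
qed

lemma iso_edge: assumes "k = 1" shows "digraph_iso D directed_edge"
proof -
  obtain u v where uv: "(u, v) \<in> A" using arcs_nonempty by auto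
  have d: "u \<noteq> v" using uv no_loop by auto
  have V: "u \<in> VD" "v \<in> VD" using uv in_arcsD1 in_arcsD2 by blast+
  have N: "N u = {v}" "N v = {u}"
    using card_ge_imp_eq[OF fin_N, of "[v]" u] card_ge_imp_eq[OF fin_N, of "[u]" v]
      card_N[OF V(1)] card_N[OF V(2)] assms uv by (simp_all add: N_def)
  have VD: "VD = {u, v}" by (rule closed_eq_V) (use V N in auto)
  define g where "g = (\<lambda>n::nat. if n = 0 then u else v)"
  show ?thesis
    by (rule iso_if_arcs_preserved[of g])
      (use d VD uv assms in \<open>auto simp: g_def directed_edge_def inj_on_def\<close>)
qed

text \<open>The two neighbours of a vertex would have three common neighbours, exceeding their
  degree.\<close>

lemma k_not_2: assumes "a = 0" shows "k \<noteq> 2"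
proof
  assume "k = 2"
  obtain u v where uv: "(u, v) \<in> A" using arcs_nonempty by auto
  have V: "u \<in> VD" "v \<in> VD" using uv in_arcsD1 in_arcsD2 by blast+
  have "card (N u) = 2" using card_N[OF V(1)] \<open>k = 2\<close> by simp
  then obtain x y where N: "N u = {x, y}" "x \<noteq> y" by (auto simp: card_2_iff)
  then have xy: "u \<in> N x" "u \<in> N y" using N_sym by blast+
  have "card (N x \<inter> N y) \<le> card (N x)" using fin_N by (intro card_mono) auto
  also have "\<dots> = 2" using card_N[of x] N_in_VD[OF xy(1)] \<open>k = 2\<close> by simp
  finally show False using common_three(1)[OF assms xy N(2)] by simp
qed

lemma iso_D33_if_matching:
  assumes d: "distinct [p1, p2, p3, q1, q2, q3]" and V: "VD = {p1, p2, p3, q1, q2, q3}" and "k = 3"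
    and arcs: "(p1, q1) \<in> A" "(p2, q2) \<in> A" "(p3, q3) \<in> A" "(q1, p2) \<in> A" "(q1, p3) \<in> A"
      "(q2, p1) \<in> A" "(q2, p3) \<in> A" "(q3, p1) \<in> A" "(q3, p2) \<in> A"
  shows "digraph_iso D D33"
proof -
  \<comment> \<open>In \<open>D33\<close> the arcs leaving the part X, Y, Z form the perfect
    matching X to V, Y to W, Z to U; these pairs become \<open>p1 q1\<close>, \<open>p2 q2\<close>,
    \<open>p3 q3\<close>.\<close>
  define g where "g x = (case x of X \<Rightarrow> p1 | V \<Rightarrow> q1 | Y \<Rightarrow> p2 | W \<Rightarrow> q2 | Z \<Rightarrow> p3 | U \<Rightarrow> q3)" for x
  show ?thesis
    by (rule iso_if_arcs_preserved[of g])
      (use d V arcs \<open>k = 3\<close> in \<open>auto simp: g_def D33_def inj_on_def\<close>)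
qed

text \<open>Vertices with a common neighbour share three, hence all, of their neighbours, so the
  underlying graph is complete bipartite. Unique two-step paths within \<open>P\<close> then fix the
  orientation up to exchanging the two parts.\<close>

lemma iso_D33: assumes "a = 0" "k = 3" shows "digraph_iso D D33"
proof -
  have c3: "card (N x) = 3" if "x \<in> VD" for x using card_N[OF that] assms(2) by simp
  have same: "N x = N y" if xy: "z \<in> N x" "z \<in> N y" for x y z
  proof (cases "x = y")
    case False
    have c: "card (N x \<inter> N y) = 3" by (rule common_three(1)[OF assms(1) xy False])
    have "card (N x) = 3" "card (N y) = 3" using c3 N_in_VD xy by blast+
    then show ?thesis using card_subset_eq[OF fin_N, of "N x \<inter> N y"] c by (metis inf_le1 inf_le2)
  qed simp
  obtain u v where uv: "(u, v) \<in> A" using arcs_nonempty by auto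
  define P where "P = N v"
  define Q where "Q = N u"
  have u: "u \<in> P" "v \<in> Q" using uv by (simp_all add: P_def Q_def N_def)
  have NQ: "N p = Q" if "p \<in> P" for p
    using same[of v p u] that uv unfolding P_def Q_def N_def by auto
  have NP: "N q = P" if "q \<in> Q" for q
    using same[of u q v] that uv unfolding P_def Q_def N_def by auto
  have V: "u \<in> VD" "v \<in> VD" using uv in_arcsD1 in_arcsD2 by blast+
  have "P \<union> Q \<subseteq> VD" using N_sub by (simp add: P_def Q_def)
  then have VD: "VD = P \<union> Q" by (rule closed_eq_V) (use u NQ NP in blast)+
  have disj: "P \<inter> Q = {}" using NQ NP N_irrefl by blast
  have cP: "card P = 3" and cQ: "card Q = 3" using c3 V by (simp_all add: P_def Q_def)
  have adj: "(p, q) \<in> A \<or> (q, p) \<in> A" "(p, q) \<in> A \<Longrightarrow> (q, p) \<notin> A" if "p \<in> P" "q \<in> Q" for p q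
    using NQ[OF that(1)] that(2) asym_arcs by (auto simp: N_def)
  have ex1: "\<exists>!w. (p, w) \<in> A \<and> (w, p') \<in> A" if "p \<in> P" "p' \<in> P" "p \<noteq> p'" for p p'
    using common_three(2)[OF assms(1), of v p p'] NQ that u by blast
  obtain p1 p2 p3 where P: "P = {p1, p2, p3}" and p: "p1 \<noteq> p2" "p1 \<noteq> p3" "p2 \<noteq> p3"
    using cP by (auto simp: card_3_iff)
  have pP: "p1 \<in> P" "p2 \<in> P" "p3 \<in> P" using P by auto
  obtain q1 where q1: "(p1, q1) \<in> A" "(q1, p2) \<in> A" using ex1[OF pP(1,2) p(1)] by blast
  obtain q2 where q2: "(p2, q2) \<in> A" "(q2, p1) \<in> A" using ex1[OF pP(2,1)] p(1) by blast
  have q12: "q1 \<noteq> q2" using q1 q2 asym_arcs by blast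
  have qQ: "q1 \<in> Q" "q2 \<in> Q" using q1 q2 NQ pP by (auto simp: N_def)
  have "card (Q - {q1, q2}) = 1" using cQ qQ q12 by (simp add: card_Diff_subset)
  then obtain q3 where "Q - {q1, q2} = {q3}" by (auto simp: card_1_singleton_iff)
  then have Q: "Q = {q1, q2, q3}" "q3 \<noteq> q1" "q3 \<noteq> q2" "q3 \<in> Q" using qQ by auto
  have d: "distinct [p1, p2, p3, q1, q2, q3]" using p q12 Q disj P by auto
  have V6: "VD = {p1, p2, p3, q1, q2, q3}" using VD P Q by auto
  have wQ: "w \<in> Q" if "(p, w) \<in> A" "p \<in> P" for p w using NQ[OF that(2)] that(1) by (auto simp: N_def)
  note a3 = adj[OF pP(1) Q(4)] adj[OF pP(2) Q(4)] adj[OF pP(3) Q(4)]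
    adj[OF pP(3) qQ(1)] adj[OF pP(3) qQ(2)] adj[OF pP(1) qQ(1)] adj[OF pP(1) qQ(2)]
    adj[OF pP(2) qQ(1)] adj[OF pP(2) qQ(2)]
  have ex: "(p, q1) \<in> A \<and> (q1, p') \<in> A \<or> (p, q2) \<in> A \<and> (q2, p') \<in> A \<or> (p, q3) \<in> A \<and> (q3, p') \<in> A"
    if "p \<in> P" "p' \<in> P" "p \<noteq> p'" for p p'
    using ex1[OF that] wQ[OF _ that(1)] Q(1) by blast
  have un: "w = w'" if "(p, w) \<in> A" "(w, p') \<in> A" "(p, w') \<in> A" "(w', p') \<in> A" "p \<in> P" "p' \<in> P" "p \<noteq> p'" for p p' w w'
    using ex1[OF that(5-7)] that by blast
  show ?thesis
  proof (cases "(q3, p1) \<in> A")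
    case True
    \<comment> \<open>Otherwise \<open>p2\<close>, \<open>q3\<close>, \<open>p1\<close> would be a
      second path beside the one through \<open>q2\<close>.\<close>
    have 2: "(q3, p2) \<in> A"
      using un[OF q2 _ True pP(2,1)] p(1) a3 Q(3) by blast
    have "(q1, p3) \<in> A" using ex[OF pP(1,3) p(2)] True 2 a3 q1 q2 by blast
    moreover have "(q2, p3) \<in> A" using ex[OF pP(2,3) p(3)] True 2 a3 q1 q2 by blast
    moreover have "(p3, q3) \<in> A" using ex[OF pP(3,1)] p(2) calculation a3 q1 q2 by metis
    ultimately show ?thesis
      using iso_D33_if_matching[OF d V6 assms(2)] True 2 q1 q2 by blast
  next
    case False
    then have F: "(p1, q3) \<in> A" using a3 by blast
    \<comment> \<open>Otherwise \<open>p1\<close>, \<open>q3\<close>, \<open>p2\<close> would be a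
      second path beside the one through \<open>q1\<close>.\<close>
    have 2: "(p2, q3) \<in> A"
      using un[OF q1 F _ pP(1,2) p(1)] a3 Q(2) by blast
    have "(p3, q2) \<in> A" using ex[OF pP(3,1)] p(2) F 2 a3 q1 q2 by metis
    moreover have "(p3, q1) \<in> A" using ex[OF pP(3,2)] p(3) F 2 a3 q1 q2 by metis
    moreover have "(q3, p3) \<in> A" using ex[OF pP(1,3) p(2)] calculation a3 q1 q2 by metis
    \<comment> \<open>Here the matching leaves \<open>Q\<close> instead: \<open>q1\<close> to
      \<open>p2\<close>, \<open>q2\<close> to \<open>p1\<close>, \<open>q3\<close> to
      \<open>p3\<close>. So the parts are exchanged, and \<open>p1\<close> and \<open>p2\<close>
      with them.\<close>
    moreover have "distinct [q1, q2, q3, p2, p1, p3]" "VD = {q1, q2, q3, p2, p1, p3}" using d V6 by auto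
    ultimately show ?thesis
      using iso_D33_if_matching[OF _ _ assms(2), of q1 q2 q3 p2 p1 p3] F 2 q1 q2 by blast
  qed
qed

end

section \<open>Degree four\<close>

context two_eigenvalue_graph
begin

text \<open>For these values the right-hand side of \<open>outdeg_variance\<close> vanishes, so
  every out-degree is \<open>k / 2\<close>.\<close>

lemma outdeg_2: assumes "a = 0" "k = 4" "u \<in> VD" shows "card {w. (u, w) \<in> A} = 2"
proof -
  have "(\<Sum>u\<in>VD. (2 * outdeg u - k)\<^sup>2) = 0" using outdeg_variance assms by simp
  then have "outdeg u = 2" using assms fin_V by (simp add: sum_nonneg_eq_0_iff)
  then show ?thesis using card_out[of u] by simp
qed

lemma iso_D55_if_five_cycle:
  assumes d: "distinct [p0, p1, p2, p3, p4, q0, q1, q2, q3, q4]"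
    and V: "VD = {p0, p1, p2, p3, p4, q0, q1, q2, q3, q4}" and "k = 4"
    and arcs: "(p0, q1) \<in> A" "(p0, q4) \<in> A" "(p1, q2) \<in> A" "(p1, q0) \<in> A" "(p2, q3) \<in> A"
      "(p2, q1) \<in> A" "(p3, q4) \<in> A" "(p3, q2) \<in> A" "(p4, q0) \<in> A" "(p4, q3) \<in> A"
      "(q2, p0) \<in> A" "(q3, p0) \<in> A" "(q3, p1) \<in> A" "(q4, p1) \<in> A" "(q4, p2) \<in> A"
      "(q0, p2) \<in> A" "(q0, p3) \<in> A" "(q1, p3) \<in> A" "(q1, p4) \<in> A" "(q2, p4) \<in> A"
  shows "digraph_iso D D55"
proof -
  \<comment> \<open>In the cyclic order V, W, Y, Z, X, each vertex of the first part of
    \<open>D55\<close> points to the second-part copies of its two cyclic neighbours, as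
    \<open>p0\<close> points to \<open>q1\<close> and \<open>q4\<close>.\<close>
  define g where "g x = (case x of V1 \<Rightarrow> p0 | W1 \<Rightarrow> p1 | Y1 \<Rightarrow> p2 | Z1 \<Rightarrow> p3 | X1 \<Rightarrow> p4
    | V2 \<Rightarrow> q0 | W2 \<Rightarrow> q1 | Y2 \<Rightarrow> q2 | Z2 \<Rightarrow> q3 | X2 \<Rightarrow> q4)" for x
  show ?thesis
  proof (rule iso_if_arcs_preserved[of g])
    show "inj_on g (pverts D55)" using d by (auto simp: g_def D55_def)
    show "VD = g ` pverts D55" by (simp add: V g_def D55_def insert_commute)
    show "(g x, g y) \<in> A" if "(x, y) \<in> parcs D55" for x y
      using that arcs by (auto simp: g_def D55_def)
    show "2 * real (card (parcs D55)) = k * card (pverts D55)"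
      using \<open>k = 4\<close> by (simp add: D55_def)
  qed (auto simp: D55_def)
qed

text \<open>Two vertices with a common neighbour share exactly three of their four neighbours.
  Starting from \<open>p0\<close>, this determines the underlying graph, with \<open>p i\<close>
  adjacent to \<open>q k\<close> exactly for distinct indices; unique two-step paths then reduce the
  orientation to \<open>five_cycle\<close>.\<close>

lemma iso_D55: assumes "a = 0" "k = 4" shows "digraph_iso D D55"
proof -
  have c4: "card (N x) = 4" if "x \<in> VD" for x using card_N[OF that] assms(2) by simp
  obtain p0 where p0: "p0 \<in> VD" using arcs_nonempty in_arcsD1 by fastforce
  let ?O = "{w. (p0, w) \<in> A}" and ?I = "{w. (w, p0) \<in> A}"
  have N0: "N p0 = ?O \<union> ?I" by (auto simp: N_def)
  have dis: "?O \<inter> ?I = {}" using asym_arcs by auto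
  have fin: "finite ?O" "finite ?I" using fin_N[of p0] unfolding N0 by simp_all
  have cO: "card ?O = 2" by (rule outdeg_2[OF assms p0])
  have cI: "card ?I = 2" using card_Un_disjoint[OF fin dis] c4[OF p0] cO N0 by simp
  obtain q1 q2 where O: "?O = {q1, q2}" "q1 \<noteq> q2" using cO by (auto simp: card_2_iff)
  obtain q3 q4 where I: "?I = {q3, q4}" "q3 \<noteq> q4" using cI by (auto simp: card_2_iff)
  have Np0: "N p0 = {q1, q2, q3, q4}" using N0 O I by auto
  have dq: "distinct [q1, q2, q3, q4]" using O I dis by auto
  have N4: "N x = {b, c, d, e}" if "{b, c, d, e} \<subseteq> N x" "distinct [b, c, d, e]" for x b c d e
    using card_ge_imp_eq[OF fin_N, of "[b, c, d, e]" x] c4[of x] that N_in_VD[of b x] by simp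
  have diff: "\<exists>t. t \<in> N x \<and> t \<notin> N y" if "z \<in> N x" "z \<in> N y" "x \<noteq> y" for x y z
  proof (rule ccontr)
    assume "\<not> ?thesis"
    then have "N x \<inter> N y = N x" by auto
    then show False using common_three(1)[OF assms(1) that] c4[of x] N_in_VD[OF that(1)] by simp
  qed
  have nN: "y \<notin> N x" if "x \<in> N z" "y \<in> N z" for x y z
    using triangle_free[OF assms(1) that(1)] that(2) by auto
  \<comment> \<open>Since \<open>x\<close> shares three of the four neighbours of \<open>y\<close>,
    missing one of them means having the other three.\<close>
  have miss: "{b, c, d} \<subseteq> N x" if "N y = {e, b, c, d}" "distinct [e, b, c, d]" "z \<in> N x" "z \<in> N y" "e \<notin> N x" "x \<noteq> y"
    for x y z e b c d
  proof -
    have "card (N y \<inter> N x) = 3" using common_three(1)[OF assms(1) that(4,3)] that(6) by simp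
    then show ?thesis using three_of_four[OF that(2) _ that(5)] unfolding that(1) by blast
  qed
  have qp: "p0 \<in> N q1" "p0 \<in> N q2" "p0 \<in> N q3" "p0 \<in> N q4" using Np0 N_sym by blast+
  \<comment> \<open>Each \<open>p i\<close> with \<open>1 \<le> i \<le> 4\<close> is chosen
    non-adjacent to \<open>q i\<close>; \<open>miss\<close>, applied to \<open>p0\<close>, makes it
    adjacent to the remaining three neighbours of \<open>p0\<close>.\<close>
  obtain p2 where p2: "p2 \<in> N q1" "p2 \<notin> N q2" using diff[OF qp(1,2)] dq by auto
  obtain p3 where p3: "p3 \<in> N q1" "p3 \<notin> N q3" using diff[OF qp(1,3)] dq by auto
  obtain p4 where p4: "p4 \<in> N q1" "p4 \<notin> N q4" using diff[OF qp(1,4)] dq by auto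
  obtain p1 where p1: "p1 \<in> N q2" "p1 \<notin> N q1" using diff[OF qp(2,1)] dq by auto
  have a2: "{q1, q3, q4} \<subseteq> N p2"
    by (rule miss[of p0 q2 q1 q3 q4 q1]) (use Np0 dq p2 qp N_sym[of p2 q1] N_sym[of p2 q2] in auto)
  have a3: "{q1, q2, q4} \<subseteq> N p3"
    by (rule miss[of p0 q3 q1 q2 q4 q1]) (use Np0 dq p3 qp N_sym[of p3 q1] N_sym[of p3 q3] in auto)
  have a4: "{q1, q2, q3} \<subseteq> N p4"
    by (rule miss[of p0 q4 q1 q2 q3 q1]) (use Np0 dq p4 qp N_sym[of p4 q1] N_sym[of p4 q4] in auto)
  have a1: "{q2, q3, q4} \<subseteq> N p1"
    by (rule miss[of p0 q1 q2 q3 q4 q2]) (use Np0 dq p1 qp N_sym[of p1 q2] N_sym[of p1 q1] in auto)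
  have in_N: "p3 \<in> N q2" "p4 \<in> N q2" "p2 \<in> N q3" "p4 \<in> N q3" "p2 \<in> N q4" "p3 \<in> N q4" "p1 \<in> N q3" "p1 \<in> N q4"
    using a1 a2 a3 a4 unfolding N_sym[of _ q2] N_sym[of _ q3] N_sym[of _ q4] by simp_all
  have dp: "distinct [p0, p1, p2, p3, p4]" using p1 p2 p3 p4 qp in_N by auto
  have Nq: "N q1 = {p0, p2, p3, p4}" "N q2 = {p0, p1, p3, p4}" "N q3 = {p0, p1, p2, p4}" "N q4 = {p0, p1, p2, p3}"
    by (rule N4, use dp qp in_N p1 p2 p3 p4 in simp, use dp in simp)+
  \<comment> \<open>This is the fourth neighbour of \<open>p1\<close>, the one that
    \<open>p0\<close> lacks. Comparing it with \<open>q2\<close> and with \<open>q3\<close> yields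
    all its neighbours.\<close>
  obtain q0 where q0: "q0 \<in> N p1" "q0 \<notin> N p0"
    using diff[of q2 p1 p0] a1 Np0 dp by auto
  have q0d: "q0 \<noteq> q1" "q0 \<noteq> q2" "q0 \<noteq> q3" "q0 \<noteq> q4" using q0(2) Np0 by auto
  have p0q0: "p0 \<notin> N q0" "p1 \<in> N q0" using q0 by (simp_all add: N_sym[of _ q0])
  have "{p1, p3, p4} \<subseteq> N q0"
    by (rule miss[of q2 p0 p1 p3 p4 p1]) (use Nq dp p0q0 q0d in auto)
  moreover have "{p1, p2, p4} \<subseteq> N q0"
    by (rule miss[of q3 p0 p1 p2 p4 p1]) (use Nq dp p0q0 q0d in auto)
  ultimately have Nq0: "N q0 = {p1, p2, p3, p4}" by (intro N4) (use dp in auto)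
  then have b: "q0 \<in> N p2" "q0 \<in> N p3" "q0 \<in> N p4" by (simp_all add: N_sym[of q0])
  have Np: "N p1 = {q0, q2, q3, q4}" "N p2 = {q0, q1, q3, q4}" "N p3 = {q0, q1, q2, q4}" "N p4 = {q0, q1, q2, q3}"
    by (rule N4, use a1 a2 a3 a4 b q0 in simp, use dq q0d in simp)+
  define p where "p = (!) [p0, p1, p2, p3, p4]"
  define q where "q = (!) [q0, q1, q2, q3, q4]"
  have pq: "p 0 = p0" "p 1 = p1" "p 2 = p2" "p 3 = p3" "p 4 = p4"
    "q 0 = q0" "q 1 = q1" "q 2 = q2" "q 3 = q3" "q 4 = q4"
    by (simp_all add: p_def q_def)
  have pq': "p (Suc 0) = p1" "q (Suc 0) = q1" using pq by simp_all
  have less5: "i < 5 \<longleftrightarrow> i = 0 \<or> i = 1 \<or> i = 2 \<or> i = 3 \<or> i = 4" for i :: nat by linarith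
  have others: "{k::nat. k < 5 \<and> k \<noteq> 0} = {1, 2, 3, 4}" "{k::nat. k < 5 \<and> k \<noteq> 1} = {0, 2, 3, 4}"
    "{k::nat. k < 5 \<and> k \<noteq> 2} = {0, 1, 3, 4}" "{k::nat. k < 5 \<and> k \<noteq> 3} = {0, 1, 2, 4}"
    "{k::nat. k < 5 \<and> k \<noteq> 4} = {0, 1, 2, 3}" by auto
  have Npi: "N (p i) = q ` {k. k < 5 \<and> k \<noteq> i}" if i: "i < 5" for i
    using i[unfolded less5] by (elim disjE) (simp_all only: others pq Np Np0 image_insert image_empty)
  have Nwp: "w \<in> N (p i) \<longleftrightarrow> (\<exists>k<5. k \<noteq> i \<and> w = q k)" if i: "i < 5" for i w
    unfolding Npi[OF i] by blast
  have injq: "k = l" if "q k = q l" "k < 5" "l < 5" for k l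
    using that dq q0d unfolding less5 by (elim disjE) (auto simp: pq pq')
  define r where "r i k \<longleftrightarrow> (p i, q k) \<in> A" for i k
  have rev: "(q k, p i) \<in> A \<longleftrightarrow> \<not> r i k" if "i < 5" "k < 5" "i \<noteq> k" for i k
  proof -
    have "q k \<in> N (p i)" using Nwp that by auto
    then show ?thesis using asym_arcs unfolding N_def r_def by blast
  qed
  have injp: "p i \<noteq> p j" if "i < 5" "j < 5" "i \<noteq> j" for i j
    using that dp unfolding less5 by (elim disjE) (auto simp: pq pq')
  \<comment> \<open>\<open>p i\<close> and \<open>p j\<close> share a neighbour \<open>q l\<close>,
    so exactly one two-step path leads from \<open>p i\<close> to \<open>p j\<close>. Its middle
    vertex is some \<open>q m\<close>, and its second arc says that \<open>p j\<close> does not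
    point to \<open>q m\<close>.\<close>
  have "\<exists>!k. k < 5 \<and> k \<noteq> i \<and> k \<noteq> j \<and> r i k \<and> \<not> r j k" if ij: "i < 5" "j < 5" "i \<noteq> j" for i j
  proof -
    have "\<exists>l<5. l \<noteq> i \<and> l \<noteq> j" by presburger
    then obtain l where l: "l < 5" "l \<noteq> i" "l \<noteq> j" by blast
    then have "q l \<in> N (p i)" "q l \<in> N (p j)" using Nwp ij by blast+
    from common_three(2)[OF assms(1) this injp[OF ij]]
    obtain w where "(p i, w) \<in> A \<and> (w, p j) \<in> A"
      and uniq: "\<forall>w'. (p i, w') \<in> A \<and> (w', p j) \<in> A \<longrightarrow> w' = w"
      by (rule ex1E)
    then have w: "(p i, w) \<in> A" "(w, p j) \<in> A" by blast+
    then have "w \<in> N (p i)" "w \<in> N (p j)" by (simp_all add: N_def)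
    then obtain m m' where m: "m < 5" "m \<noteq> i" "w = q m" "m' < 5" "m' \<noteq> j" "w = q m'"
      using Nwp ij by blast
    then have "m \<noteq> j" using injq by metis
    show ?thesis
    proof (rule ex1I[of _ m])
      show "m < 5 \<and> m \<noteq> i \<and> m \<noteq> j \<and> r i m \<and> \<not> r j m"
        using m \<open>m \<noteq> j\<close> w rev[of j m] ij unfolding r_def by auto
      fix k assume k: "k < 5 \<and> k \<noteq> i \<and> k \<noteq> j \<and> r i k \<and> \<not> r j k"
      then have "(p i, q k) \<in> A" "(q k, p j) \<in> A" using rev[of j k] ij unfolding r_def by auto
      then have "q k = q m" using uniq m(3) by blast
      then show "k = m" using injq k m by blast
    qed
  qed
  moreover have r0: "r 0 1" "r 0 2" "\<not> r 0 3" "\<not> r 0 4"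
    using O I rev[of 0 3] rev[of 0 4] pq unfolding r_def by auto
  ultimately have cyc: "(r 1 0 \<and> \<not> r 1 2 \<and> r 1 3 \<and> \<not> r 1 4 \<and> r 2 0 \<and> \<not> r 2 1 \<and> \<not> r 2 3 \<and> r 2 4 \<and>
      \<not> r 3 0 \<and> r 3 1 \<and> \<not> r 3 2 \<and> r 3 4 \<and> \<not> r 4 0 \<and> \<not> r 4 1 \<and> r 4 2 \<and> r 4 3) \<or>
    (r 1 0 \<and> \<not> r 1 2 \<and> \<not> r 1 3 \<and> r 1 4 \<and> r 2 0 \<and> \<not> r 2 1 \<and> r 2 3 \<and> \<not> r 2 4 \<and>
      \<not> r 3 0 \<and> \<not> r 3 1 \<and> r 3 2 \<and> r 3 4 \<and> \<not> r 4 0 \<and> r 4 1 \<and> \<not> r 4 2 \<and> r 4 3)"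
    by (rule five_cycle)
  have VD: "VD = {p0, p1, p2, p3, p4, q0, q1, q2, q3, q4}"
  proof (rule closed_eq_V)
    show "{p0, p1, p2, p3, p4, q0, q1, q2, q3, q4} \<subseteq> VD"
      using N_in_VD p0 p1 p2 p3 p4 q0 qp by blast
    show "N u \<subseteq> {p0, p1, p2, p3, p4, q0, q1, q2, q3, q4}"
      if "u \<in> {p0, p1, p2, p3, p4, q0, q1, q2, q3, q4}" for u
      using that by (elim insertE emptyE) (simp_all add: Np Np0 Nq Nq0)
  qed simp
  \<comment> \<open>It remains to separate the two families: adjacent vertices differ as there are
    no loops, and \<open>p i = q i\<close> for \<open>i \<ge> 1\<close> would make two neighbours of
    \<open>p0\<close> adjacent.\<close>
  have off: "p0 \<noteq> q1" "p0 \<noteq> q2" "p0 \<noteq> q3" "p0 \<noteq> q4" "p1 \<noteq> q0" "p1 \<noteq> q2" "p1 \<noteq> q3" "p1 \<noteq> q4"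
    "p2 \<noteq> q0" "p2 \<noteq> q1" "p2 \<noteq> q3" "p2 \<noteq> q4" "p3 \<noteq> q0" "p3 \<noteq> q1" "p3 \<noteq> q2" "p3 \<noteq> q4"
    "p4 \<noteq> q0" "p4 \<noteq> q1" "p4 \<noteq> q2" "p4 \<noteq> q3"
    using N_irrefl[of p0] N_irrefl[of p1] N_irrefl[of p2] N_irrefl[of p3] N_irrefl[of p4]
    unfolding Np Np0 by simp_all
  have "q2 \<notin> N q1" "q1 \<notin> N q2" "q1 \<notin> N q3" "q1 \<notin> N q4" by (rule nN[of _ p0]; simp add: Np0)+
  then have diag: "p1 \<noteq> q1" "p2 \<noteq> q2" "p3 \<noteq> q3" "p4 \<noteq> q4" using Np by auto
  have "p0 \<noteq> q0" using Np0 Nq0 off diag by auto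
  then have dpq: "distinct [p0, p1, p2, p3, p4, q0, q1, q2, q3, q4]"
    using dp dq q0d off diag by auto
  note arcs = rev[of 0 3] rev[of 0 4] rev[of 1 2] rev[of 1 3] rev[of 1 4] rev[of 2 1] rev[of 2 3] rev[of 2 4]
    rev[of 3 0] rev[of 3 1] rev[of 3 2] rev[of 3 4] rev[of 4 0] rev[of 4 1] rev[of 4 2] rev[of 4 3]
  \<comment> \<open>The indices are listed in the order in which the respective 5-cycle visits
    them.\<close>
  from cyc show ?thesis
  proof (elim disjE)
    assume c: "r 1 0 \<and> \<not> r 1 2 \<and> r 1 3 \<and> \<not> r 1 4 \<and> r 2 0 \<and> \<not> r 2 1 \<and> \<not> r 2 3 \<and> r 2 4 \<and>
      \<not> r 3 0 \<and> r 3 1 \<and> \<not> r 3 2 \<and> r 3 4 \<and> \<not> r 4 0 \<and> \<not> r 4 1 \<and> r 4 2 \<and> r 4 3"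
    show ?thesis
      by (rule iso_D55_if_five_cycle[of p0 p1 p3 p4 p2 q0 q1 q3 q4 q2])
        (use dpq VD assms(2) c r0 arcs in \<open>auto simp: r_def pq pq'\<close>)
  next
    assume c: "r 1 0 \<and> \<not> r 1 2 \<and> \<not> r 1 3 \<and> r 1 4 \<and> r 2 0 \<and> \<not> r 2 1 \<and> r 2 3 \<and> \<not> r 2 4 \<and>
      \<not> r 3 0 \<and> \<not> r 3 1 \<and> r 3 2 \<and> r 3 4 \<and> \<not> r 4 0 \<and> r 4 1 \<and> \<not> r 4 2 \<and> r 4 3"
    show ?thesis
      by (rule iso_D55_if_five_cycle[of p0 p1 p4 p3 p2 q0 q1 q4 q3 q2])
        (use dpq VD assms(2) c r0 arcs in \<open>auto simp: r_def pq pq'\<close>)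
  qed
qed

end

section \<open>Spectra and the classification\<close>

lemma (in oriented_graph) hermitian_kernel_H: "hermitian_kernel (pverts D) (H_entry D)"
  using pair_finite_verts asym_arcs by unfold_locales (auto simp: H_entry_def)

lemma (in oriented_graph) H_spectrum_eq_eigenvalues:
  "H_spectrum D = {c. hermitian_kernel.is_eigenvalue (pverts D) (H_entry D) c}"
proof -
  interpret hermitian_kernel "pverts D" "H_entry D" by (rule hermitian_kernel_H)
  obtain vs where vs: "distinct vs" "set vs = pverts D"
    using finite_distinct_list[OF pair_finite_verts] by blast
  show ?thesis
    unfolding H_spectrum_eq[OF vs] spectrum_def eigenvalue_H_omega_iff[OF vs(1)] is_eigenvalue_def mat_op_def vs(2) ..
qed

text \<open>Reduces a spectrum to checking the square of the matrix; any arc supplies the nonzero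
  off-diagonal entry.\<close>

lemma (in oriented_graph) H_spectrum_eqI:
  assumes "\<And>u v. \<lbrakk>u \<in> pverts D; v \<in> pverts D\<rbrakk> \<Longrightarrow>
      (\<Sum>w\<in>pverts D. H_entry D u w * H_entry D w v) = s * H_entry D u v - (if u = v then m else 0)"
    and "s = \<theta> + \<tau>" "m = \<theta> * \<tau>" and arc: "(u\<^sub>0, v\<^sub>0) \<in> parcs D"
  shows "H_spectrum D = {\<theta>, \<tau>}"
proof -
  have "omega \<noteq> 0" by (simp add: complex_eq_iff)
  then have "H_entry D u\<^sub>0 v\<^sub>0 \<noteq> 0" using arc by (simp add: H_entry_def)
  then show ?thesis
    unfolding H_spectrum_eq_eigenvalues
    using arc assms(1) in_arcsD1 in_arcsD2 no_loops' unfolding assms(2,3)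
    by (intro hermitian_kernel.eigenvalues_if_square_eq[OF hermitian_kernel_H, of _ _ u\<^sub>0 v\<^sub>0]) auto
qed

section \<open>The spectra of the four graphs\<close>

lemma cnj_omega: "cnj omega = 1 - omega"
  by (simp add: complex_eq_iff)

text \<open>\<open>omega\<close> is a primitive sixth root of unity, a root of
  \<open>X\<^sup>2 - X + 1\<close>; the rules make every product of entries linear in
  \<open>omega\<close>.\<close>

lemma omega_products:
  "omega * omega = omega - 1" "cnj omega * cnj omega = - omega"
  "omega * cnj omega = 1" "cnj omega * omega = 1"
  by (simp_all add: complex_eq_iff)

lemma H_spectrum_directed_edge: "H_spectrum directed_edge = {1, -1}"
proof (rule oriented_graph.H_spectrum_eqI[OF oriented_graph_directed_edge, where s = 0 and m = "-1" and u\<^sub>0 = 0 and v\<^sub>0 = 1])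
  fix u v assume "u \<in> pverts directed_edge" "v \<in> pverts directed_edge"
  then show "(\<Sum>w\<in>pverts directed_edge. H_entry directed_edge u w * H_entry directed_edge w v)
      = 0 * H_entry directed_edge u v - (if u = v then - 1 else 0)"
    by (auto simp: directed_edge_def H_entry_def cnj_omega omega_products algebra_simps)
qed (simp_all add: directed_edge_def)

lemma H_spectrum_directed_triangle: "H_spectrum directed_triangle = {1, -2}"
proof (rule oriented_graph.H_spectrum_eqI[OF oriented_graph_directed_triangle, where s = "-1" and m = "-2" and u\<^sub>0 = 0 and v\<^sub>0 = 1])
  fix u v assume "u \<in> pverts directed_triangle" "v \<in> pverts directed_triangle"
  then show "(\<Sum>w\<in>pverts directed_triangle. H_entry directed_triangle u w * H_entry directed_triangle w v)
      = - 1 * H_entry directed_triangle u v - (if u = v then - 2 else 0)"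
    by (auto simp: directed_triangle_def H_entry_def cnj_omega omega_products algebra_simps)
qed (simp_all add: directed_triangle_def)

text \<open>A lookup table, so that entries evaluate without searching the arc list.\<close>

lemma H_entry_D33: "H_entry D33 u v = (case u of
      U \<Rightarrow> (case v of X \<Rightarrow> omega | Y \<Rightarrow> omega | Z \<Rightarrow> cnj omega | _ \<Rightarrow> 0)
    | V \<Rightarrow> (case v of X \<Rightarrow> cnj omega | Y \<Rightarrow> omega | Z \<Rightarrow> omega | _ \<Rightarrow> 0)
    | W \<Rightarrow> (case v of X \<Rightarrow> omega | Y \<Rightarrow> cnj omega | Z \<Rightarrow> omega | _ \<Rightarrow> 0)
    | X \<Rightarrow> (case v of U \<Rightarrow> cnj omega | V \<Rightarrow> omega | W \<Rightarrow> cnj omega | _ \<Rightarrow> 0)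
    | Y \<Rightarrow> (case v of U \<Rightarrow> cnj omega | V \<Rightarrow> cnj omega | W \<Rightarrow> omega | _ \<Rightarrow> 0)
    | Z \<Rightarrow> (case v of U \<Rightarrow> omega | V \<Rightarrow> cnj omega | W \<Rightarrow> cnj omega | _ \<Rightarrow> 0))"
  by (cases u; cases v; simp add: H_entry_def D33_def)

lemma sum_pverts_D33: "(\<Sum>w\<in>pverts D33. f w) = f U + f V + f W + f X + f Y + f Z"
  for f :: "_ \<Rightarrow> complex"
  by (simp add: D33_def add.assoc)

lemma H_spectrum_D33: "H_spectrum D33 = {complex_of_real (sqrt 3), - complex_of_real (sqrt 3)}"
proof (rule oriented_graph.H_spectrum_eqI[OF oriented_graph_D33, where s = 0 and m = "-3" and u\<^sub>0 = U and v\<^sub>0 = X])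
  fix u v
  show "(\<Sum>w\<in>pverts D33. H_entry D33 u w * H_entry D33 w v)
      = 0 * H_entry D33 u v - (if u = v then - 3 else 0)"
    unfolding sum_pverts_D33 by (cases u; cases v; simp add: H_entry_D33 omega_products; simp add: cnj_omega)
qed (simp_all add: D33_def flip: of_real_mult)

lemma H_entry_D55: "H_entry D55 u v = (case u of
      V1 \<Rightarrow> (case v of W2 \<Rightarrow> omega | X2 \<Rightarrow> omega | Y2 \<Rightarrow> cnj omega | Z2 \<Rightarrow> cnj omega | _ \<Rightarrow> 0)
    | W1 \<Rightarrow> (case v of V2 \<Rightarrow> omega | X2 \<Rightarrow> cnj omega | Y2 \<Rightarrow> omega | Z2 \<Rightarrow> cnj omega | _ \<Rightarrow> 0)
    | X1 \<Rightarrow> (case v of V2 \<Rightarrow> omega | W2 \<Rightarrow> cnj omega | Y2 \<Rightarrow> cnj omega | Z2 \<Rightarrow> omega | _ \<Rightarrow> 0)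
    | Y1 \<Rightarrow> (case v of V2 \<Rightarrow> cnj omega | W2 \<Rightarrow> omega | X2 \<Rightarrow> cnj omega | Z2 \<Rightarrow> omega | _ \<Rightarrow> 0)
    | Z1 \<Rightarrow> (case v of V2 \<Rightarrow> cnj omega | W2 \<Rightarrow> cnj omega | X2 \<Rightarrow> omega | Y2 \<Rightarrow> omega | _ \<Rightarrow> 0)
    | V2 \<Rightarrow> (case v of W1 \<Rightarrow> cnj omega | X1 \<Rightarrow> cnj omega | Y1 \<Rightarrow> omega | Z1 \<Rightarrow> omega | _ \<Rightarrow> 0)
    | W2 \<Rightarrow> (case v of V1 \<Rightarrow> cnj omega | X1 \<Rightarrow> omega | Y1 \<Rightarrow> cnj omega | Z1 \<Rightarrow> omega | _ \<Rightarrow> 0)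
    | X2 \<Rightarrow> (case v of V1 \<Rightarrow> cnj omega | W1 \<Rightarrow> omega | Y1 \<Rightarrow> omega | Z1 \<Rightarrow> cnj omega | _ \<Rightarrow> 0)
    | Y2 \<Rightarrow> (case v of V1 \<Rightarrow> omega | W1 \<Rightarrow> cnj omega | X1 \<Rightarrow> omega | Z1 \<Rightarrow> cnj omega | _ \<Rightarrow> 0)
    | Z2 \<Rightarrow> (case v of V1 \<Rightarrow> omega | W1 \<Rightarrow> omega | X1 \<Rightarrow> cnj omega | Y1 \<Rightarrow> cnj omega | _ \<Rightarrow> 0))"
  by (cases u; cases v; simp add: H_entry_def D55_def)

lemma sum_pverts_D55: "(\<Sum>w\<in>pverts D55. f w) = f V1 + f W1 + f X1 + f Y1 + f Z1 + f V2 + f W2 + f X2 + f Y2 + f Z2"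
  for f :: "_ \<Rightarrow> complex"
  by (simp add: D55_def add.assoc)

lemma H_spectrum_D55: "H_spectrum D55 = {2, -2}"
proof (rule oriented_graph.H_spectrum_eqI[OF oriented_graph_D55, where s = 0 and m = "-4" and u\<^sub>0 = V1 and v\<^sub>0 = W2])
  fix u v
  show "(\<Sum>w\<in>pverts D55. H_entry D55 u w * H_entry D55 w v)
      = 0 * H_entry D55 u v - (if u = v then - 4 else 0)"
    unfolding sum_pverts_D55 by (cases u; cases v; simp add: H_entry_D55 omega_products; simp add: cnj_omega)
qed (simp_all add: D55_def flip: of_real_mult)

text \<open>The eigenvalues are real, so their sum and product give real parameters. Without arcs
  the matrix would be 0, with no eigenvalue besides 0.\<close>

lemma (in oriented_graph) two_eigenvalue_graph_if_card_2:
  assumes "connected D" "card (H_spectrum D) = 2"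
  shows "\<exists>a k. two_eigenvalue_graph D a k"
proof -
  interpret hermitian_kernel "pverts D" "H_entry D" by (rule hermitian_kernel_H)
  obtain \<theta> \<tau> where sp: "{c. is_eigenvalue c} = {\<theta>, \<tau>}" "\<theta> \<noteq> \<tau>"
    using assms(2) unfolding H_spectrum_eq_eigenvalues by (auto simp: card_2_iff)
  then have ev: "is_eigenvalue \<theta>" "is_eigenvalue \<tau>" by auto
  then have real: "\<theta> \<in> \<real>" "\<tau> \<in> \<real>" using eigenvalue_real by (simp_all add: Reals_cnj_iff)
  have "is_eigenvalue c \<Longrightarrow> c = \<theta> \<or> c = \<tau>" for c using sp(1) by auto
  note sq = square_eq_if_two_eigenvalues[OF this]
  have ne: "parcs D \<noteq> {}"
  proof
    assume "parcs D = {}"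
    then have "c = 0" if "is_eigenvalue c" for c
      using that by (auto simp: is_eigenvalue_def mat_op_def H_entry_def)
    then show False using ev sp(2) by metis
  qed
  have "two_eigenvalue_graph D (Re (\<theta> + \<tau>)) (- Re (\<theta> * \<tau>))"
  proof unfold_locales
    fix u v assume "u \<in> pverts D" "v \<in> pverts D"
    moreover have "complex_of_real (Re (\<theta> + \<tau>)) = \<theta> + \<tau>" "complex_of_real (Re (\<theta> * \<tau>)) = \<theta> * \<tau>"
      using real by (simp_all add: Reals_add Reals_mult of_real_Re del: plus_complex.sel times_complex.sel)
    ultimately show "(\<Sum>w\<in>pverts D. H_entry D u w * H_entry D w v)
      = complex_of_real (Re (\<theta> + \<tau>)) * H_entry D u v + (if u = v then complex_of_real (- Re (\<theta> * \<tau>)) else 0)"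
      by (simp add: sq del: plus_complex.sel times_complex.sel)
  qed (use ne assms(1) in auto)
  then show ?thesis by blast
qed

lemma (in two_eigenvalue_graph) classification:
  "digraph_iso D directed_edge \<or> digraph_iso D directed_triangle \<or> digraph_iso D D33 \<or> digraph_iso D D55"
proof (cases "a = 0")
  case True
  obtain u where "u \<in> VD" using arcs_nonempty in_arcsD1 by fastforce
  \<comment> \<open>As a vertex degree \<open>k\<close> is an integer, so the bounds
    \<open>1 \<le> k \<le> 4\<close> leave four cases.\<close>
  then have k: "k = real (card (N u))" using card_N by simp
  then have "card (N u) \<in> {1..4}" using k_bound True by simp
  then have "k = 1 \<or> k = 2 \<or> k = 3 \<or> k = 4" unfolding k by auto
  then show ?thesis using iso_edge k_not_2 iso_D33 iso_D55 True by blast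
qed (use iso_triangle in blast)

theorem theorem1p1:
  shows "(\<forall>D :: 'a pair_pre_digraph.
            oriented_graph D \<and> connected D \<and> card (H_spectrum D) = 2 \<longrightarrow>
              digraph_iso D directed_edge \<or> digraph_iso D directed_triangle \<or>
              digraph_iso D D33 \<or> digraph_iso D D55) \<and>
         H_spectrum directed_edge = {1, -1} \<and>
         H_spectrum directed_triangle = {1, -2} \<and>
         H_spectrum D33 = {complex_of_real (sqrt 3), - complex_of_real (sqrt 3)} \<and>
         H_spectrum D55 = {2, -2}"
  using oriented_graph.two_eigenvalue_graph_if_card_2 two_eigenvalue_graph.classification
    H_spectrum_directed_edge H_spectrum_directed_triangle H_spectrum_D33 H_spectrum_D55
  by blast

end
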